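(* For all $k\in S\setminus\{2n-2\}$ and all $(t,j)\in A$, the inequality $$x_{1,j,t}+x_{k,j,t}+\sum_{i\in V\setminus\{t\}}x_{k,t,i}+x_{k+1,j,t}-1\le y_{t,t,j}$$ is facet-defining for $P_{\mathrm{utt}}(n)$.
   Context: Let $n\ge4$ be even, $V=\{1,\dots,n\}$ (teams; team $i$ has home venue $i$), $S=\{1,\dots,2n-2\}$ (slots), $A=\{(i,j)\in V\times V:i\ne j\}$, $\mathcal M=\{(k,i,j):k\in S,(i,j)\in A\}$, where $(k,i,j)$ denotes the match between $i$ and $j$ at venue $i$ in slot $k$. Coordinates are $x_{k,i,j}$ ($(k,i,j)\in\mathcal M$) and $y_{t,i,j}$ ($t\in V$, $(i,j)\in A$). A tournament is a set $T\subseteq\mathcal M$ whose incidence vector $x=\chi(T)\in\{0,1\}^{\mathcal M}$ satisfies $\sum_{j\in V\setminus\{i\}}(x_{k,i,j}+x_{k,j,i})=1$ for all $k\in S$, $k\ge2$, $i\in V$, and $\sum_{k\in S}x_{k,i,j}=1$ for all $(i,j)\in A$. In $T$, team $t$ is at venue $t$ in a slot where it plays at home and at venue $i$ in slot $k$ if $(k,i,t)\in T$; before slot 1 and after slot $2n-2$ it is at venue $t$. Team $t$ travels from venue $i$ to venue $j\ne i$ if it is at $i$ and then at $j$ at consecutive positions of (start, slot $1$, …, slot $2n-2$, end). The travel vector $\psi(T)\in\{0,1\}^{V\times A}$ has $\psi(T)_{t,i,j}=1$ iff team $t$ travels from $i$ to $j$. $P_{\mathrm{utt}}(n)=\mathrm{conv}\{(\chi(T),y)\in\{0,1\}^{\mathcal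 M}\times\{0,1\}^{V\times A}: T\text{ tournament},\ y\ge\psi(T)\}$. An inequality is facet-defining if it is valid and the face it induces is a facet. *)

theory Defs
  imports "HOL-Analysis.Analysis"
begin

definition teams :: "nat \<Rightarrow> nat set" where
  "teams n = {1..n}"

definition slots :: "nat \<Rightarrow> nat set" where
  "slots n = {1..2 * n - 2}"

definition arcs :: "nat \<Rightarrow> (nat \<times> nat) set" where
  "arcs n = {(i, j). i \<in> teams n \<and> j \<in> teams n \<and> i \<noteq> j}"

text \<open>The triple (k, i, j) is the match between i and j at venue i in slot k.\<close>

definition matches :: "nat \<Rightarrow> (nat \<times> nat \<times> nat) set" where
  "matches n = slots n \<times> arcs n"

text \<open>The degree condition is not imposed for slot 1, where it follows from the other conditions.\<close>

definition tournament :: "nat \<Rightarrow> (nat \<times> nat \<times> nat) set \<Rightarrow> bool" where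
  "tournament n T \<longleftrightarrow>
     T \<subseteq> matches n \<and>
     (\<forall>k \<in> slots n. k \<ge> 2 \<longrightarrow> (\<forall>i \<in> teams n.
        (\<Sum>j \<in> teams n - {i}. indicator T (k, i, j) + indicator T (k, j, i)) = (1 :: real))) \<and>
     (\<forall>(i, j) \<in> arcs n. (\<Sum>k \<in> slots n. indicator T (k, i, j)) = (1 :: real))"

text \<open>
  Position 0 is the start, position k with 1 \<le> k \<le> 2n - 2 is slot k, and position 2n - 1 is the end.
\<close>

definition at_venue :: "nat \<Rightarrow> (nat \<times> nat \<times> nat) set \<Rightarrow> nat \<Rightarrow> nat \<Rightarrow> nat \<Rightarrow> bool" where
  "at_venue n T t k v \<longleftrightarrow>
     (if k \<in> slots n then (v = t \<and> (\<exists>j. (k, t, j) \<in> T)) \<or> (k, v, t) \<in> T else v = t)"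

definition travels :: "nat \<Rightarrow> (nat \<times> nat \<times> nat) set \<Rightarrow> nat \<Rightarrow> nat \<Rightarrow> nat \<Rightarrow> bool" where
  "travels n T t i j \<longleftrightarrow>
     i \<noteq> j \<and> (\<exists>k \<in> {0..2 * n - 2}. at_venue n T t k i \<and> at_venue n T t (k + 1) j)"

text \<open>
  Index types for the coordinates: for \<open>n = CARD('n)\<close> they are copies of \<open>matches n\<close> and of
  \<open>teams n \<times> arcs n\<close>. The number n is encoded as the cardinality of a type because
  Euclidean spaces are indexed by types. The maximum with 2 has no effect for \<open>n \<ge> 2\<close>;
  it only makes the types inhabited for every argument type.
\<close>

typedef 'n match_ix = "matches (max 2 CARD('n))"
proof
  show "(1, 1, 2) \<in> matches (max 2 CARD('n))"
    by (auto simp: matches_def slots_def arcs_def teams_def)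
qed

typedef 'n travel_ix = "teams (max 2 CARD('n)) \<times> arcs (max 2 CARD('n))"
proof
  show "(1, 1, 2) \<in> teams (max 2 CARD('n)) \<times> arcs (max 2 CARD('n))"
    by (auto simp: arcs_def teams_def)
qed

lemma finite_teams: "finite (teams n)"
  by (simp add: teams_def)

lemma finite_slots: "finite (slots n)"
  by (simp add: slots_def)

lemma finite_arcs: "finite (arcs n)"
  by (rule finite_subset[of _ "teams n \<times> teams n"]) (auto simp: arcs_def finite_teams)

lemma finite_matches: "finite (matches n)"
  by (simp add: matches_def finite_slots finite_arcs)

instance match_ix :: (type) finite
proof
  show "finite (UNIV :: 'a match_ix set)"
    using type_definition.Abs_image[OF type_definition_match_ix] finite_matches
    by (metis finite_imageI)
qed

instance travel_ix :: (type) finite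
proof
  show "finite (UNIV :: 'a travel_ix set)"
    using type_definition.Abs_image[OF type_definition_travel_ix] finite_teams finite_arcs
    by (metis finite_imageI finite_cartesian_product)
qed

definition chi :: "(nat \<times> nat \<times> nat) set \<Rightarrow> real ^ 'n match_ix" where
  "chi T = (\<chi> m. indicator T (Rep_match_ix m))"

definition psi :: "(nat \<times> nat \<times> nat) set \<Rightarrow> real ^ 'n travel_ix" where
  "psi T = (\<chi> c. case Rep_travel_ix c of (t, i, j) \<Rightarrow> of_bool (travels CARD('n) T t i j))"

definition P_utt :: "((real ^ 'n match_ix) \<times> (real ^ 'n travel_ix)) set" where
  "P_utt = convex hull
     {(chi T, y) | T y. tournament CARD('n) T \<and> (\<forall>c. y $ c \<in> {0, 1}) \<and> (\<forall>c. psi T $ c \<le> y $ c)}"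

text \<open>
  Coordinates of a point. They are meaningful only for \<open>(k, i, j) \<in> matches n\<close> and
  \<open>(t, i, j) \<in> teams n \<times> arcs n\<close> respectively; in particular only for \<open>i \<noteq> j\<close>.
\<close>

definition xc :: "(real ^ 'n match_ix) \<times> (real ^ 'n travel_ix) \<Rightarrow> nat \<Rightarrow> nat \<Rightarrow> nat \<Rightarrow> real" where
  "xc p k i j = fst p $ Abs_match_ix (k, i, j)"

definition yc :: "(real ^ 'n match_ix) \<times> (real ^ 'n travel_ix) \<Rightarrow> nat \<Rightarrow> nat \<Rightarrow> nat \<Rightarrow> real" where
  "yc p t i j = snd p $ Abs_travel_ix (t, i, j)"

text \<open>The inequality \<open>l p \<le> r p\<close> (for affine functions l and r) is facet-defining for P.\<close>

definition facet_defining ::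
    "'a::euclidean_space set \<Rightarrow> ('a \<Rightarrow> real) \<Rightarrow> ('a \<Rightarrow> real) \<Rightarrow> bool" where
  "facet_defining P l r \<longleftrightarrow> (\<forall>p \<in> P. l p \<le> r p) \<and> {p \<in> P. l p = r p} facet_of P"

end

theory Submission
  imports Defs "HOL-Combinatorics.Transposition"
begin

text \<open>
  Call a tournament tight if some vertex (chi T, y) of the face lies over it. If a linear
  functional is constant on the face, changing a single y-coordinate over a suitable tight
  tournament shows that its coefficient at every coordinate other than y(t, t, j) is 0. Adding a
  multiple of the inequality removes the remaining one, so it suffices to prove that a weight
  function c on the matches whose total is constant on tight tournaments has constant total on
  all tournaments.

  Every one-factorization of the complete graph gives tournaments in which each of its matchings
  is played twice, with any assignment to the slots and any orientation. Tournaments with the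
  match (j, t) in slot k + 1 are always tight, so interchanging two other slots p, q shows that
  D = c p - c q has the same sum on any two matchings of a one-factorization that avoid the arc
  (j, t). This forces D a b = u a + u b for (a, b) different from (j, t). Slot k + 1 is treated
  in the same way using tournaments with (j, t) in slot 1 and t at home in slot k. Hence the
  total weight depends only on the slot of (j, t), and each slot is attained by a tight
  tournament.
\<close>

section \<open>Sums over arcs, extension of partial bijections, choice of spare teams\<close>

lemma mem_arcs: "(a, b) \<in> arcs n \<longleftrightarrow> a \<in> teams n \<and> b \<in> teams n \<and> a \<noteq> b"
  by (auto simp: arcs_def)

lemma arcs_Sigma: "arcs n = Sigma (teams n) (\<lambda>a. teams n - {a})"
  by (auto simp: arcs_def)

lemma sum_arcs: "(\<Sum>(a, b)\<in>arcs n. F a b) = (\<Sum>a\<in>teams n. \<Sum>b\<in>teams n - {a}. F a b)"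
  by (simp add: arcs_Sigma sum.Sigma finite_teams)

lemma sum_arcs_flip:
  fixes F :: "nat \<Rightarrow> nat \<Rightarrow> 'a::comm_monoid_add"
  shows "(\<Sum>(a, b)\<in>arcs n. F a b) = (\<Sum>(a, b)\<in>arcs n. F b a)"
  by (rule sum.reindex_bij_witness[of _ prod.swap prod.swap]) (auto simp: arcs_def)

lemma sum_indicator_eq_1_iff:
  assumes "finite S"
  shows "(\<Sum>x\<in>S. indicator T (g x)) = (1::real) \<longleftrightarrow> (\<exists>!x. x \<in> S \<and> g x \<in> T)"
proof -
  have "(\<Sum>x\<in>S. indicator T (g x)) = real (card {x \<in> S. g x \<in> T})"
    using assms by (simp add: indicator_def if_distrib sum.If_cases Int_def flip: of_bool_def)
  then show ?thesis
    by (auto simp: card_1_singleton_iff) (metis (mono_tags, lifting) mem_Collect_eq singletonD singletonI)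
qed

text \<open>The complements of \<open>P\<close> and of its image have the same size, so any
  bijection between them completes \<open>g\<close>. It is used both to relabel teams and to fill
  the slots around a few prescribed rounds.\<close>

lemma bij_betw_extend:
  assumes "finite A" "finite B" "card A = card B" "P \<subseteq> A" "inj_on g P" "g ` P \<subseteq> B"
  obtains s where "bij_betw s A B" "\<And>x. x \<in> P \<Longrightarrow> s x = g x"
proof -
  have "card (A - P) = card (B - g ` P)"
    using assms by (simp add: card_Diff_subset card_image finite_subset)
  then obtain h where h: "bij_betw h (A - P) (B - g ` P)"
    using assms by (metis finite_Diff finite_same_card_bij)
  define s where "s x = (if x \<in> P then g x else h x)" for x
  have "bij_betw s P (g ` P)"
    using assms(5) by (auto simp: s_def bij_betw_def inj_on_def)
  moreover have "bij_betw s (A - P) (B - g ` P)"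
    using h by (subst bij_betw_cong[where g = h]) (auto simp: s_def)
  ultimately have "bij_betw s (P \<union> (A - P)) (g ` P \<union> (B - g ` P))"
    by (rule bij_betw_combine) auto
  moreover have "P \<union> (A - P) = A" "g ` P \<union> (B - g ` P) = B"
    using assms by auto
  ultimately show ?thesis
    using that[of s] by (simp add: s_def)
qed

lemma ex_team:
  assumes "finite P" "card P < n"
  obtains x where "x \<in> teams n" "x \<notin> P"
proof -
  have "\<not> teams n \<subseteq> P"
    using card_mono[OF assms(1), of "teams n"] assms(2) by (auto simp: teams_def)
  then show ?thesis
    using that by blast
qed

lemma ex_team_avoiding_three:
  assumes "n \<ge> 4"
  obtains x where "x \<in> teams n" "x \<noteq> a" "x \<noteq> b" "x \<noteq> c"
proof -
  have "card {a, b, c} < n"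
    using assms by (simp add: card_insert_if)
  then obtain x where "x \<in> teams n" "x \<notin> {a, b, c}"
    using ex_team by (metis finite.emptyI finite_insert)
  then show ?thesis
    using that by blast
qed

section \<open>Tournaments\<close>

lemma tournament_subset: "tournament n T \<Longrightarrow> T \<subseteq> matches n"
  by (simp add: tournament_def)

lemma tournament_mem:
  assumes "tournament n T" "(p, a, b) \<in> T"
  shows "p \<in> slots n" "a \<in> teams n" "b \<in> teams n" "a \<noteq> b"
  using tournament_subset[OF assms(1)] assms(2) by (auto simp: matches_def arcs_def)

lemma tournament_arc_sum:
  "tournament n T \<Longrightarrow> (a, b) \<in> arcs n \<Longrightarrow> (\<Sum>p\<in>slots n. indicator T (p, a, b)) = (1::real)"
  unfolding tournament_def by fast

lemma tournament_arc_ex1: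
  "tournament n T \<Longrightarrow> (a, b) \<in> arcs n \<Longrightarrow> \<exists>!p. p \<in> slots n \<and> (p, a, b) \<in> T"
  using tournament_arc_sum[of n T a b] by (simp add: sum_indicator_eq_1_iff finite_slots)

lemma tournament_slot_unique:
  assumes "tournament n T" "(p, a, b) \<in> T" "(q, a, b) \<in> T"
  shows "p = q"
proof -
  have "(a, b) \<in> arcs n" "p \<in> slots n" "q \<in> slots n"
    using tournament_mem[OF assms(1)] assms(2,3) by (auto simp: mem_arcs)
  then show ?thesis
    using tournament_arc_ex1[OF assms(1)] assms(2,3) by blast
qed

lemma slots_split: "n \<ge> 2 \<Longrightarrow> slots n = insert 1 {2..2 * n - 2}"
  by (auto simp: slots_def)

text \<open>Double counting gives slot 1: over all slots team i meets each of the other n - 1 teams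
  twice, which makes 2 * (n - 1) matches, and the 2 * n - 3 slots from 2 on account for all but one
  of them.\<close>

lemma tournament_degree:
  assumes T: "tournament n T" and "n \<ge> 2" and p: "p \<in> slots n" and i: "i \<in> teams n"
  shows "(\<Sum>j\<in>teams n - {i}. indicator T (p, i, j) + indicator T (p, j, i)) = (1::real)"
proof -
  define d where "d q = (\<Sum>j\<in>teams n - {i}. indicator T (q, i, j) + indicator T (q, j, i) :: real)" for q
  have d: "d q = 1" if "q \<in> {2..2 * n - 2}" for q
    using T that i unfolding d_def tournament_def slots_def by auto
  have "(\<Sum>q\<in>slots n. d q) = (\<Sum>j\<in>teams n - {i}. \<Sum>q\<in>slots n. indicator T (q, i, j) + indicator T (q, j, i))"
    unfolding d_def by (rule sum.swap)
  also have "\<dots> = (\<Sum>j\<in>teams n - {i}. 2)"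
    using i T by (intro sum.cong) (auto simp: sum.distrib tournament_arc_sum mem_arcs)
  also have "\<dots> = 2 * (real n - 1)"
    using i \<open>n \<ge> 2\<close> by (simp add: teams_def)
  finally have "d 1 + (\<Sum>q\<in>{2..2 * n - 2}. d q) = 2 * (real n - 1)"
    using \<open>n \<ge> 2\<close> by (simp add: slots_split)
  moreover have "(\<Sum>q\<in>{2..2 * n - 2}. d q) = 2 * (real n - 1) - 1"
    using d \<open>n \<ge> 2\<close> by (simp add: of_nat_diff)
  ultimately have "d 1 = 1"
    by simp
  then have "d p = 1"
    using d p \<open>n \<ge> 2\<close> by (auto simp: slots_split)
  then show ?thesis
    by (simp add: d_def)
qed

lemma tournament_home_away:
  assumes T: "tournament n T" and "n \<ge> 2" and "(p, i, a) \<in> T" "(p, b, i) \<in> T"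
  shows False
proof -
  note mem = tournament_mem[OF T]
  have "(1::real) \<le> (\<Sum>j\<in>teams n - {i}. indicator T (p, i, j))"
    using member_le_sum[of a "teams n - {i}" "\<lambda>j. indicator T (p, i, j) :: real"] assms(3) mem[OF assms(3)]
    by (simp add: finite_teams)
  moreover have "(1::real) \<le> (\<Sum>j\<in>teams n - {i}. indicator T (p, j, i))"
    using member_le_sum[of b "teams n - {i}" "\<lambda>j. indicator T (p, j, i) :: real"] assms(4) mem[OF assms(4)]
    by (simp add: finite_teams)
  ultimately show False
    using tournament_degree[OF T \<open>n \<ge> 2\<close>, of p i] mem[OF assms(3)] by (simp add: sum.distrib)
qed

lemma tournament_home_sum:
  assumes T: "tournament n T" and "n \<ge> 2" and p: "p \<in> slots n" and i: "i \<in> teams n"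
  shows "(\<Sum>j\<in>teams n - {i}. indicator T (p, i, j)) = (of_bool (\<exists>a. (p, i, a) \<in> T) :: real)"
proof (cases "\<exists>a. (p, i, a) \<in> T")
  case True
  then obtain a where a: "(p, i, a) \<in> T"
    by auto
  then have "(p, j, i) \<notin> T" for j
    using tournament_home_away[OF T \<open>n \<ge> 2\<close>] by blast
  then show ?thesis
    using tournament_degree[OF T assms(2) p i] True by simp
qed simp

text \<open>A team can be at a venue other than its own only through a match there, so the trip ends
  in a slot. The position \<open>p\<close> before it may be 0, the start.\<close>

lemma travels_to_away:
  assumes "travels n T t i j" "j \<noteq> t"
  obtains p where "p + 1 \<in> slots n" "(p + 1, j, t) \<in> T" "at_venue n T t p i"
proof -
  obtain p where p: "p \<in> {0..2 * n - 2}" "at_venue n T t p i" "at_venue n T t (p + 1) j"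
    using assms by (auto simp: travels_def)
  then have "p + 1 \<in> slots n \<and> (p + 1, j, t) \<in> T"
    using assms(2) by (auto simp: at_venue_def split: if_splits)
  then show ?thesis
    using that p by blast
qed

lemma travels_from_away:
  assumes "travels n T t i j" "i \<noteq> t"
  obtains p where "p \<in> slots n" "(p, i, t) \<in> T" "at_venue n T t (p + 1) j"
proof -
  obtain p where p: "p \<in> {0..2 * n - 2}" "at_venue n T t p i" "at_venue n T t (p + 1) j"
    using assms by (auto simp: travels_def)
  then have "p \<in> slots n \<and> (p, i, t) \<in> T"
    using assms(2) by (auto simp: at_venue_def split: if_splits)
  then show ?thesis
    using that p by blast
qed

lemma at_home_iff:
  assumes "tournament n T" "p \<in> slots n"
  shows "at_venue n T t p t \<longleftrightarrow> (\<exists>a. (p, t, a) \<in> T)"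
  using assms tournament_mem(4)[OF assms(1), of p t t] by (auto simp: at_venue_def)

section \<open>One-factorizations\<close>

text \<open>A proper edge colouring of the complete graph with n - 1 colours, given by its colour
  function. That the colour classes are perfect matchings then follows by counting colours at each
  team.\<close>

definition one_factorization :: "nat \<Rightarrow> (nat \<Rightarrow> nat \<Rightarrow> nat) \<Rightarrow> bool" where
  "one_factorization n col \<longleftrightarrow>
     (\<forall>(a, b) \<in> arcs n. col a b = col b a \<and> col a b < n - 1) \<and>
     (\<forall>a \<in> teams n. inj_on (col a) (teams n - {a}))"

lemma one_factorizationD:
  assumes "one_factorization n col" "a \<in> teams n" "b \<in> teams n" "a \<noteq> b"
  shows "col b a = col a b" "col a b < n - 1"
    "\<And>c. c \<in> teams n \<Longrightarrow> c \<noteq> a \<Longrightarrow> col a c = col a b \<longleftrightarrow> c = b"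
proof -
  show "col b a = col a b" "col a b < n - 1"
    using assms by (auto simp: one_factorization_def mem_arcs)
  have "inj_on (col a) (teams n - {a})"
    using assms by (simp add: one_factorization_def)
  then show "\<And>c. c \<in> teams n \<Longrightarrow> c \<noteq> a \<Longrightarrow> col a c = col a b \<longleftrightarrow> c = b"
    using assms by (auto dest: inj_onD)
qed

text \<open>Team a has n - 1 edges of distinct colours among n - 1 colours, so every colour occurs
  at a.\<close>

lemma one_factorization_mate:
  assumes "one_factorization n col" "a \<in> teams n" "f < n - 1"
  obtains b where "b \<in> teams n" "b \<noteq> a" "col a b = f"
proof -
  have inj: "inj_on (col a) (teams n - {a})"
    using assms by (simp add: one_factorization_def)
  have sub: "col a ` (teams n - {a}) \<subseteq> {..<n - 1}"
    using one_factorizationD[OF assms(1,2)] by auto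
  have "card (col a ` (teams n - {a})) = card {..<n - 1}"
    using assms(2) card_image[OF inj] by (simp add: teams_def)
  then have "col a ` (teams n - {a}) = {..<n - 1}"
    using sub by (metis card_subset_eq finite_lessThan)
  then have "f \<in> col a ` (teams n - {a})"
    using assms(3) by blast
  then show ?thesis
    using that by auto
qed

section \<open>The circle method\<close>

text \<open>The classical round-robin colouring: teams 1 to n - 1 are residues modulo n - 1, and
  team n is the centre. The edge from a to n receives the colour 2 * a, the one value that a + b
  misses while b runs over the other residues.\<close>

definition circle_colour :: "nat \<Rightarrow> nat \<Rightarrow> nat \<Rightarrow> nat" where
  "circle_colour n a b =
     (if b = n then 2 * a else if a = n then 2 * b else a + b) mod (n - 1)"

lemma mod_eq_imp_dvd_diff_nat:
  "(b::nat) mod m = c mod m \<Longrightarrow> m dvd b - c"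
  by (cases "c \<le> b") (simp_all add: mod_eq_dvd_iff_nat)

lemma add_mod_cancel_nat:
  fixes a b c m :: nat
  assumes "(a + b) mod m = (a + c) mod m" "b \<in> {1..m}" "c \<in> {1..m}"
  shows "b = c"
proof -
  have "m dvd b - c" "m dvd c - b"
    using mod_eq_imp_dvd_diff_nat[OF assms(1)] mod_eq_imp_dvd_diff_nat[OF assms(1)[symmetric]] by auto
  then have "b - c = 0" "c - b = 0"
    using assms(2,3) by (auto dest!: dvd_imp_le)
  then show ?thesis by simp
qed

text \<open>Doubling is injective modulo an odd number; this separates the colours at the centre
  n.\<close>

lemma double_mod_cancel_nat:
  fixes b c m :: nat
  assumes "(2 * b) mod m = (2 * c) mod m" "odd m" "b \<in> {1..m}" "c \<in> {1..m}"
  shows "b = c"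
proof -
  have "m dvd 2 * (b - c)" "m dvd 2 * (c - b)"
    using mod_eq_imp_dvd_diff_nat[OF assms(1)] mod_eq_imp_dvd_diff_nat[OF assms(1)[symmetric]]
    by (auto simp: diff_mult_distrib2)
  moreover have "coprime m 2"
    using assms(2) by simp
  ultimately have "m dvd b - c" "m dvd c - b"
    using coprime_dvd_mult_right_iff by blast+
  then have "b - c = 0" "c - b = 0"
    using assms(3,4) by (auto dest!: dvd_imp_le)
  then show ?thesis by simp
qed

lemma one_factorization_circle:
  assumes "n \<ge> 2" "even n"
  shows "one_factorization n (circle_colour n)"
proof -
  have "odd (n - 1)"
    using assms by simp
  note cancel = add_mod_cancel_nat[of _ _ "n - 1"] double_mod_cancel_nat[OF _ this]
  have "inj_on (circle_colour n a) (teams n - {a})" if "a \<in> teams n" for a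
  proof (rule inj_onI)
    fix b c
    assume *: "b \<in> teams n - {a}" "c \<in> teams n - {a}" "circle_colour n a b = circle_colour n a c"
    show "b = c"
    proof (cases "a = n")
      case True
      then show ?thesis
        using * cancel(2)[of b c] by (auto simp: circle_colour_def teams_def)
    next
      case False
      then have "x \<in> {1..n - 1}" if "x \<in> {a, b, c}" "x \<noteq> n" for x
        using that * \<open>a \<in> teams n\<close> by (auto simp: teams_def)
      \<comment> \<open>One cancellation is for b and c both different from n; the other two are for
        one of them equal to n, where equal colours would force the remaining team to be a
        itself.\<close>
      then show ?thesis
        using * False cancel(1)[of a b c] cancel(1)[of a a c] cancel(1)[of a b a]
        by (auto simp: circle_colour_def mult_2 split: if_splits)
    qed
  qed
  moreover have "circle_colour n a b = circle_colour n b a" for a b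
    by (simp add: circle_colour_def add.commute)
  moreover have "circle_colour n a b < n - 1" for a b
    using assms by (simp add: circle_colour_def)
  ultimately show ?thesis
    unfolding one_factorization_def by blast
qed

lemma one_factorization_relabel:
  assumes "one_factorization n col" "bij_betw s (teams n) (teams n)"
  shows "one_factorization n (\<lambda>a b. col (s a) (s b))"
proof -
  have s: "s a \<in> teams n" if "a \<in> teams n" for a
    using that assms(2) by (auto simp: bij_betw_def)
  have eq: "s a = s b \<longleftrightarrow> a = b" if "a \<in> teams n" "b \<in> teams n" for a b
    using that assms(2) by (auto simp: bij_betw_def inj_on_def)
  have "b = c"
    if "a \<in> teams n" "b \<in> teams n - {a}" "c \<in> teams n - {a}" "col (s a) (s b) = col (s a) (s c)" for a b c
    using one_factorizationD(3)[OF assms(1), of "s a" "s c" "s b"] that s eq by auto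
  moreover have "col (s a) (s b) = col (s b) (s a)" "col (s a) (s b) < n - 1"
    if "a \<in> teams n" "b \<in> teams n" "a \<noteq> b" for a b
    using one_factorizationD(1,2)[OF assms(1), of "s a" "s b"] that s eq by auto
  ultimately show ?thesis
    unfolding one_factorization_def inj_on_def mem_arcs[symmetric] by (blast dest: mem_arcs[THEN iffD1])
qed

text \<open>The circle colouring has two disjoint edges of one colour, and relabelling the teams
  carries them to any two given disjoint edges.\<close>

lemma one_factorization_four_cycle:
  assumes "n \<ge> 4" "even n" "{a, b, c, d} \<subseteq> teams n" "distinct [a, b, c, d]"
  obtains col where "one_factorization n col" "col a b = col c d"
proof -
  \<comment> \<open>The centre n meets n - 1 in colour 2 * (n - 1), and 1 meets n - 2 in colour n -
    1. Both are 0 modulo n - 1.\<close>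
  define g where "g x = (if x = a then n else if x = b then n - 1 else if x = c then 1 else n - 2)" for x
  have g: "g a = n" "g b = n - 1" "g c = 1" "g d = n - 2"
    using assms(4) by (auto simp: g_def)
  have inj: "inj_on g {a, b, c, d}"
    using assms(1) unfolding inj_on_def ball_simps g by auto
  have sub: "g ` {a, b, c, d} \<subseteq> teams n"
    using assms(1) by (auto simp: g teams_def)
  obtain s where s: "bij_betw s (teams n) (teams n)" "\<And>x. x \<in> {a, b, c, d} \<Longrightarrow> s x = g x"
    using bij_betw_extend[OF finite_teams finite_teams refl assms(3) inj sub] by blast
  show ?thesis
  proof
    show "one_factorization n (\<lambda>a b. circle_colour n (s a) (s b))"
      using one_factorization_relabel[OF one_factorization_circle s(1)] assms(1,2) by simp
    have "1 + (n - 2) = n - 1"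
      using assms(1) by simp
    then have "circle_colour n n (n - 1) = 0" "circle_colour n 1 (n - 2) = 0"
      using assms(1) by (auto simp: circle_colour_def simp del: plus_1_eq_Suc)
    moreover have "s a = n" "s b = n - 1" "s c = 1" "s d = n - 2"
      by (simp_all add: s g)
    ultimately show "circle_colour n (s a) (s b) = circle_colour n (s c) (s d)"
      by simp
  qed
qed

section \<open>Orientations and schedules from one-factorizations\<close>

definition orientation :: "nat \<Rightarrow> (nat \<Rightarrow> nat \<Rightarrow> bool) \<Rightarrow> bool" where
  "orientation n ori \<longleftrightarrow> (\<forall>(a, b) \<in> arcs n. ori a b \<noteq> ori b a)"

lemma orientationD: "orientation n ori \<Longrightarrow> (a, b) \<in> arcs n \<Longrightarrow> ori b a \<longleftrightarrow> \<not> ori a b"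
  by (auto simp: orientation_def)

text \<open>Edges on which \<open>A\<close> is silent are directed from the smaller to the larger
  team.\<close>

lemma orientation_extend:
  assumes "\<And>a b. (a, b) \<in> A \<Longrightarrow> (b, a) \<notin> A"
  obtains ori where "orientation n ori" "\<And>a b. (a, b) \<in> A \<Longrightarrow> ori a b"
proof
  show "orientation n (\<lambda>a b. (a, b) \<in> A \<or> (b, a) \<notin> A \<and> a < b)"
    using assms by (auto simp: orientation_def arcs_def)
qed (use assms in auto)

text \<open>
  Every colour is used in two slots, so a round is a colour f together with a Boolean h; an edge ab
  of colour f is played at a in the round (f, ori a b) and at b in the other one.
\<close>

definition round_arcs :: "nat \<Rightarrow> (nat \<Rightarrow> nat \<Rightarrow> nat) \<Rightarrow> (nat \<Rightarrow> nat \<Rightarrow> bool) \<Rightarrow> nat \<times> bool \<Rightarrow> (nat \<times> nat) set" where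
  "round_arcs n col ori r = {(a, b) \<in> arcs n. (col a b, ori a b) = r}"

definition schedule :: "nat \<Rightarrow> (nat \<Rightarrow> nat \<Rightarrow> nat) \<Rightarrow> (nat \<Rightarrow> nat \<Rightarrow> bool) \<Rightarrow> (nat \<Rightarrow> nat \<times> bool) \<Rightarrow> (nat \<times> nat \<times> nat) set" where
  "schedule n col ori s = Sigma (slots n) (\<lambda>p. round_arcs n col ori (s p))"

abbreviation rounds :: "nat \<Rightarrow> (nat \<times> bool) set" where
  "rounds n \<equiv> {..<n - 1} \<times> UNIV"

lemma mem_schedule:
  "(p, a, b) \<in> schedule n col ori s \<longleftrightarrow> p \<in> slots n \<and> (a, b) \<in> arcs n \<and> s p = (col a b, ori a b)"
  by (auto simp: schedule_def round_arcs_def)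

text \<open>In a round of colour f team i meets exactly its mate of that colour, in exactly one
  direction. Each arc (a, b) lies in the single round (col a b, ori a b), and that round has a
  single slot.\<close>

lemma tournament_schedule:
  assumes col: "one_factorization n col" and ori: "orientation n ori"
    and s: "bij_betw s (slots n) (rounds n)"
  shows "tournament n (schedule n col ori s)"
proof -
  let ?T = "schedule n col ori s"
  have "(\<Sum>j\<in>teams n - {i}. indicator ?T (p, i, j) + indicator ?T (p, j, i)) = (1 :: real)"
    if p: "p \<in> slots n" and i: "i \<in> teams n" for p i
  proof -
    obtain f h where fh: "s p = (f, h)" "f < n - 1"
      using bij_betwE[OF s] p by (cases "s p") auto
    obtain m where m: "m \<in> teams n" "m \<noteq> i" "col i m = f"
      using one_factorization_mate[OF col i fh(2)] .
    have "(indicator ?T (p, i, j) + indicator ?T (p, j, i) :: real) = of_bool (j = m)"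
      if j: "j \<in> teams n - {i}" for j
    proof -
      have ij: "(i, j) \<in> arcs n" "(j, i) \<in> arcs n"
        using i j by (auto simp: mem_arcs)
      have "col j i = col i j" "col i j = f \<longleftrightarrow> j = m"
        using one_factorizationD[OF col, of i j] one_factorizationD[OF col, of i m] i j m by auto
      then show ?thesis
        using ij p fh orientationD[OF ori, of i j] by (auto simp: indicator_def mem_schedule)
    qed
    then have "(\<Sum>j\<in>teams n - {i}. indicator ?T (p, i, j) + indicator ?T (p, j, i)) = (\<Sum>j\<in>teams n - {i}. of_bool (j = m) :: real)"
      by (rule sum.cong[OF refl])
    also have "\<dots> = 1"
      using m by (simp add: finite_teams of_bool_def if_distrib sum.delta)
    finally show ?thesis .
  qed
  moreover have "(\<Sum>p\<in>slots n. indicator ?T (p, a, b)) = (1 :: real)" if ab: "(a, b) \<in> arcs n" for a b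
  proof -
    have "(col a b, ori a b) \<in> rounds n"
      using one_factorizationD(2)[OF col] ab by (auto simp: mem_arcs)
    then obtain p where "p \<in> slots n" "s p = (col a b, ori a b)"
      using s by (metis bij_betw_imp_surj_on imageE)
    then have "\<exists>!p. p \<in> slots n \<and> s p = (col a b, ori a b)"
      using bij_betw_imp_inj_on[OF s] by (metis inj_onD)
    then show ?thesis
      using ab by (simp add: sum_indicator_eq_1_iff finite_slots mem_schedule)
  qed
  ultimately show ?thesis
    by (auto simp: tournament_def schedule_def round_arcs_def matches_def)
qed

lemma card_slots_rounds: "n \<ge> 1 \<Longrightarrow> card (slots n) = card (rounds n)"
  by (simp add: slots_def card_cartesian_product)

lemma slot_assignment_extend:
  assumes "n \<ge> 1" "P \<subseteq> slots n" "inj_on g P" "g ` P \<subseteq> rounds n"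
  obtains s where "bij_betw s (slots n) (rounds n)" "\<And>p. p \<in> P \<Longrightarrow> s p = g p"
proof -
  have "finite (rounds n)"
    by simp
  from bij_betw_extend[OF finite_slots this card_slots_rounds[OF assms(1)] assms(2-4)] that
  show ?thesis by blast
qed

section \<open>Functionals that agree on rounds\<close>

lemma finite_round_arcs: "finite (round_arcs n col ori r)"
  by (rule finite_subset[OF _ finite_arcs]) (auto simp: round_arcs_def)

text \<open>Reversing all arcs exchanges the two rounds of colour f, so by symmetry of
  \<open>F\<close> they contribute equally.\<close>

lemma sum_round_arcs_undirected:
  fixes F :: "nat \<Rightarrow> nat \<Rightarrow> real"
  assumes col: "one_factorization n col" and ori: "orientation n ori"
    and sym: "\<And>a b. (a, b) \<in> arcs n \<Longrightarrow> F a b = F b a"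
  shows "(\<Sum>(a, b)\<in>{(a, b) \<in> arcs n. col a b = f}. F a b) = 2 * (\<Sum>(a, b)\<in>round_arcs n col ori (f, True). F a b)"
proof -
  let ?R = "\<lambda>h. round_arcs n col ori (f, h)"
  have split: "{(a, b) \<in> arcs n. col a b = f} = ?R True \<union> ?R False"
    by (auto simp: round_arcs_def)
  have "(\<Sum>(a, b)\<in>?R False. F a b) = (\<Sum>(a, b)\<in>?R True. F a b)"
  proof (rule sum.reindex_bij_witness[of _ prod.swap prod.swap])
    fix e
    assume "e \<in> ?R True"
    then show "prod.swap e \<in> ?R False"
      using one_factorizationD(1)[OF col] orientationD[OF ori]
      by (cases e) (auto simp: round_arcs_def mem_arcs)
  next
    fix e
    assume e: "e \<in> ?R False"
    then show "prod.swap e \<in> ?R True"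
      using one_factorizationD(1)[OF col] orientationD[OF ori]
      by (cases e) (auto simp: round_arcs_def mem_arcs)
    show "(case prod.swap e of (a, b) \<Rightarrow> F a b) = (case e of (a, b) \<Rightarrow> F a b)"
      using e sym[of "fst e" "snd e"] by (cases e) (auto simp: round_arcs_def)
  qed auto
  moreover have "?R True \<inter> ?R False = {}"
    by (auto simp: round_arcs_def)
  ultimately show ?thesis
    by (simp add: split sum.union_disjoint finite_round_arcs)
qed

text \<open>
  The transposition of the ends b, c of an edge of colour g fixes the matching of colour g and
  turns the edges ab, cd of colour f into ac, bd.
\<close>

lemma four_cycle_relation:
  fixes F :: "nat \<Rightarrow> nat \<Rightarrow> real"
  assumes n: "n \<ge> 4" "even n"
    and sym: "\<And>a b. (a, b) \<in> arcs n \<Longrightarrow> F a b = F b a"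
    and const: "\<And>col f g. one_factorization n col \<Longrightarrow> f < n - 1 \<Longrightarrow> g < n - 1 \<Longrightarrow> f \<noteq> g \<Longrightarrow>
      (\<Sum>(a, b)\<in>{(a, b) \<in> arcs n. col a b = f}. F a b) = (\<Sum>(a, b)\<in>{(a, b) \<in> arcs n. col a b = g}. F a b)"
    and abcd: "{a, b, c, d} \<subseteq> teams n" "distinct [a, b, c, d]"
  shows "F a b + F c d = F a c + F b d"
proof -
  obtain col where col: "one_factorization n col" and eq: "col a b = col c d"
    using one_factorization_four_cycle[OF n abcd] .
  define s where "s = Transposition.transpose b c"
  define col' where "col' x y = col (s x) (s y)" for x y
  define f where "f = col a b"
  define g where "g = col b c"
  note D = one_factorizationD[OF col]
  have teams: "a \<in> teams n" "b \<in> teams n" "c \<in> teams n" "d \<in> teams n"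
    using abcd by auto
  have neq: "a \<noteq> b" "a \<noteq> c" "a \<noteq> d" "b \<noteq> c" "b \<noteq> d" "c \<noteq> d"
    using abcd by auto
  have s: "s b = c" "s c = b" "\<And>x. x \<noteq> b \<Longrightarrow> x \<noteq> c \<Longrightarrow> s x = x"
    by (auto simp: s_def)
  have "bij_betw s (teams n) (teams n)"
    using teams by (simp add: s_def)
  then have col': "one_factorization n col'"
    unfolding col'_def by (rule one_factorization_relabel[OF col])
  have fg: "f < n - 1" "g < n - 1" "f \<noteq> g"
    using D(1)[of a b] D(2)[of a b] D(2)[of b c] D(3)[of b c a] teams neq
    by (auto simp: f_def g_def)
  have colb: "col b x = f \<longleftrightarrow> x = a" "col b x = g \<longleftrightarrow> x = c" if "x \<in> teams n" "x \<noteq> b" for x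
    using that D(3)[of b a x] D(3)[of b c x] D(1)[of a b] teams neq by (auto simp: f_def g_def)
  have colc: "col c x = f \<longleftrightarrow> x = d" "col c x = g \<longleftrightarrow> x = b" if "x \<in> teams n" "x \<noteq> c" for x
    using that D(3)[of c d x] D(3)[of c b x] D(1)[of b c] teams neq eq by (auto simp: f_def g_def)
  \<comment> \<open>The edges of colour \<open>h\<close> that avoid b and c, on which
    \<open>col\<close> and \<open>col'\<close> agree.\<close>
  define R where "R h = {(x, y) \<in> arcs n. x \<notin> {b, c} \<and> y \<notin> {b, c} \<and> col x y = h}" for h
  have finR: "finite (R h)" for h
    by (rule finite_subset[OF _ finite_arcs[of n]]) (auto simp: R_def)
  \<comment> \<open>Here \<open>p\<close> and \<open>q\<close> are the partners of b and c in colour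
    \<open>h\<close>. The edges bp and cq may coincide, which happens for the colour
    \<open>g\<close> of bc.\<close>
  have split: "{(x, y) \<in> arcs n. k x y = h} = R h \<union> {(b, p), (p, b), (c, q), (q, c)}"
    if k: "one_factorization n k" "\<And>x y. x \<notin> {b, c} \<Longrightarrow> y \<notin> {b, c} \<Longrightarrow> k x y = col x y"
      and pq: "(b, p) \<in> arcs n" "(c, q) \<in> arcs n"
      and kb: "\<And>x. x \<in> teams n \<Longrightarrow> x \<noteq> b \<Longrightarrow> k b x = h \<longleftrightarrow> x = p"
      and kc: "\<And>x. x \<in> teams n \<Longrightarrow> x \<noteq> c \<Longrightarrow> k c x = h \<longleftrightarrow> x = q" for k h p q
  proof -
    have kb': "k x b = h \<longleftrightarrow> x = p" if "x \<in> teams n" "x \<noteq> b" for x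
      using that kb[of x] one_factorizationD(1)[OF k(1), of b x] teams by auto
    have kc': "k x c = h \<longleftrightarrow> x = q" if "x \<in> teams n" "x \<noteq> c" for x
      using that kc[of x] one_factorizationD(1)[OF k(1), of c x] teams by auto
    have bc: "q = b \<longleftrightarrow> p = c"
      using kb[of c] kc'[of b] teams neq by auto
    have ends: "p \<in> teams n" "p \<noteq> b" "q \<in> teams n" "q \<noteq> c"
      using pq by (auto simp: mem_arcs)
    have "(x, y) \<in> arcs n \<and> k x y = h \<longleftrightarrow> (x, y) \<in> R h \<or> (x, y) \<in> {(b, p), (p, b), (c, q), (q, c)}" for x y
    proof -
      consider "x = b" | "x = c" | "y = b" | "y = c" | "x \<notin> {b, c}" "y \<notin> {b, c}"
        by blast
      then show ?thesis
      proof cases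
        case 1
        then show ?thesis
          using kb[of y] bc ends teams(2) neq(4) by (auto simp: R_def mem_arcs)
      next
        case 2
        then show ?thesis
          using kc[of y] bc ends teams(3) neq(4) by (auto simp: R_def mem_arcs)
      next
        case 3
        then show ?thesis
          using kb'[of x] bc ends teams(2) neq(4) by (auto simp: R_def mem_arcs)
      next
        case 4
        then show ?thesis
          using kc'[of x] bc ends teams(3) neq(4) by (auto simp: R_def mem_arcs)
      next
        case 5
        then show ?thesis
          using k(2)[OF 5] by (auto simp: R_def)
      qed
    qed
    then show ?thesis
      by auto
  qed
  have sum_split: "(\<Sum>(x, y)\<in>R h \<union> {(b, p), (p, b), (c, q), (q, c)}. F x y) =
      (\<Sum>(x, y)\<in>R h. F x y) + 2 * (F b p + F c q)"
    if "p \<in> {a, d}" "q \<in> {a, d}" "p \<noteq> q" for h p q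
  proof -
    have "(\<Sum>(x, y)\<in>{(b, p), (p, b), (c, q), (q, c)}. F x y) = 2 * (F b p + F c q)"
      using that neq sym[of p b] sym[of q c] teams by (auto simp: mem_arcs)
    moreover have "R h \<inter> {(b, p), (p, b), (c, q), (q, c)} = {}"
      by (auto simp: R_def)
    ultimately show ?thesis
      by (subst sum.union_disjoint) (simp_all only: finR finite.intros)
  qed
  have k': "col' b x = col c (s x)" "col' c x = col b (s x)" for x
    by (simp_all add: col'_def s)
  have sx: "s x \<in> teams n" "s x \<noteq> c \<longleftrightarrow> x \<noteq> b" "s x \<noteq> b \<longleftrightarrow> x \<noteq> c" "s x = a \<longleftrightarrow> x = a" "s x = d \<longleftrightarrow> x = d"
    if "x \<in> teams n" for x
    using that teams neq by (auto simp: s_def Transposition.transpose_def)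
  have 1: "{(x, y) \<in> arcs n. col x y = f} = R f \<union> {(b, a), (a, b), (c, d), (d, c)}"
    using col colb colc teams neq by (intro split) (auto simp: mem_arcs)
  have 2: "{(x, y) \<in> arcs n. col' x y = f} = R f \<union> {(b, d), (d, b), (c, a), (a, c)}"
  proof (rule split[OF col'])
    show "col' x y = col x y" if "x \<notin> {b, c}" "y \<notin> {b, c}" for x y
      using that by (simp add: col'_def s)
    show "col' b x = f \<longleftrightarrow> x = d" if "x \<in> teams n" "x \<noteq> b" for x
      using that colc(1)[of "s x"] sx[of x] by (simp add: k')
    show "col' c x = f \<longleftrightarrow> x = a" if "x \<in> teams n" "x \<noteq> c" for x
      using that colb(1)[of "s x"] sx[of x] by (simp add: k')
  qed (use teams neq in \<open>auto simp: mem_arcs\<close>)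
  have 3: "{(x, y) \<in> arcs n. col x y = g} = R g \<union> {(b, c), (c, b), (c, b), (b, c)}"
    using col colb colc teams neq by (intro split) (auto simp: mem_arcs)
  have 4: "{(x, y) \<in> arcs n. col' x y = g} = R g \<union> {(b, c), (c, b), (c, b), (b, c)}"
  proof (rule split[OF col'])
    show "col' x y = col x y" if "x \<notin> {b, c}" "y \<notin> {b, c}" for x y
      using that by (simp add: col'_def s)
    show "col' b x = g \<longleftrightarrow> x = c" if "x \<in> teams n" "x \<noteq> b" for x
      using that colc(2)[of "s x"] sx[of x] by (simp add: k')
    show "col' c x = g \<longleftrightarrow> x = b" if "x \<in> teams n" "x \<noteq> c" for x
      using that colb(2)[of "s x"] sx[of x] by (simp add: k')
  qed (use teams neq in \<open>auto simp: mem_arcs\<close>)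
  \<comment> \<open>The class of colour \<open>g\<close> is the same set for \<open>col\<close> and
    \<open>col'\<close>, so the classes of colour \<open>f\<close> also have equal sums; the common
    part \<open>R f\<close> then cancels.\<close>
  have "(\<Sum>(x, y)\<in>R f. F x y) + 2 * (F b a + F c d) = (\<Sum>(x, y)\<in>R f. F x y) + 2 * (F b d + F c a)"
    using const[OF col fg] const[OF col' fg] sum_split[of a d f] sum_split[of d a f] neq
    unfolding 1 2 3 4 by simp
  then show ?thesis
    using sym[of a b] sym[of a c] teams neq by (simp add: mem_arcs)
qed

section \<open>Edge functions as sums of vertex potentials\<close>

text \<open>If F a b = u a + u b, then F x y + F x z - F y z equals 2 * u x for every triangle.
  Conversely, the four-cycle relations make this expression depend on x alone, and half of it serves
  as \<open>u\<close>.\<close>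

lemma four_cycle_potential:
  fixes F :: "nat \<Rightarrow> nat \<Rightarrow> real"
  assumes n: "n \<ge> 4"
    and sym: "\<And>a b. (a, b) \<in> arcs n \<Longrightarrow> F a b = F b a"
    and rel: "\<And>a b c d. {a, b, c, d} \<subseteq> teams n \<Longrightarrow> distinct [a, b, c, d] \<Longrightarrow> F a b + F c d = F a c + F b d"
  obtains u where "\<And>a b. (a, b) \<in> arcs n \<Longrightarrow> F a b = u a + u b"
proof -
  define h where "h x y z = F x y + F x z - F y z" for x y z
  define good where "good x y z \<longleftrightarrow> {x, y, z} \<subseteq> teams n \<and> distinct [x, y, z]" for x y z
  have swap: "h x y z = h x z y" if "good x y z" for x y z
    using that sym[of y z] by (auto simp: h_def good_def mem_arcs)
  \<comment> \<open>Replacing z by w changes \<open>h\<close> by F x z + F w y - F x w - F z y,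
    which is a four-cycle relation.\<close>
  have step: "h x y z = h x y w" if "good x y z" "good x y w" for x y z w
  proof (cases "z = w")
    case False
    then show ?thesis
      using that rel[of x z w y] sym[of w y] sym[of z y] by (auto simp: h_def good_def mem_arcs)
  qed simp
  \<comment> \<open>The pair y, z is moved to y', z' by changing one entry at a time and swapping.
    If y = z', the usual intermediate pair y, z' degenerates and a shorter route is taken.\<close>
  have indep: "h x y z = h x y' z'" if g: "good x y z" "good x y' z'" for x y z y' z'
  proof (cases "y = z'")
    case True
    then have "good x y y'"
      using g by (auto simp: good_def)
    then show ?thesis
      using True g step[of x y z y'] swap[of x y y'] by simp
  next
    case False
    then have *: "good x y z'" "good x z' y" "good x z' y'"
      using g by (auto simp: good_def)
    then show ?thesis
      using step[of x y z z'] swap[of x y z'] step[of x z' y y'] swap[of x z' y'] g by simp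
  qed
  define u where "u x = (SOME r. \<exists>y z. good x y z \<and> r = h x y z / 2)" for x
  have u: "u x = h x y z / 2" if "good x y z" for x y z
    unfolding u_def
  proof (rule some_equality)
    show "\<exists>y' z'. good x y' z' \<and> h x y z / 2 = h x y' z' / 2"
      using that by blast
    show "r = h x y z / 2" if "\<exists>y z. good x y z \<and> r = h x y z / 2" for r
      using that indep[OF \<open>good x y z\<close>] by metis
  qed
  show ?thesis
  proof
    fix a b
    assume ab: "(a, b) \<in> arcs n"
    have fin: "finite {a, b}" and card: "card {a, b} < n"
      using n ab by (simp_all add: mem_arcs)
    obtain z where "z \<in> teams n" "z \<notin> {a, b}"
      using ex_team[OF fin card] by blast
    then show "F a b = u a + u b"
      using ab u[of a b z] u[of b a z] sym[of a b] by (auto simp: h_def good_def mem_arcs)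
  qed
qed

text \<open>With \<open>ori t j\<close>, the rounds marked \<open>True\<close> may contain (t, j)
  but never (j, t), so the hypothesis constrains \<open>D\<close> only off (j, t). Reversing single
  edges shows that \<open>D\<close> is symmetric there, which reduces the claim to undirected colour
  classes and hence to four-cycles.\<close>

lemma rounds_potential:
  fixes D :: "nat \<Rightarrow> nat \<Rightarrow> real"
  assumes n: "n \<ge> 4" "even n" and tj: "(t, j) \<in> arcs n"
    and const: "\<And>col ori f g. one_factorization n col \<Longrightarrow> orientation n ori \<Longrightarrow> ori t j \<Longrightarrow>
      f < n - 1 \<Longrightarrow> g < n - 1 \<Longrightarrow> f \<noteq> g \<Longrightarrow>
      (\<Sum>(a, b)\<in>round_arcs n col ori (f, True). D a b) = (\<Sum>(a, b)\<in>round_arcs n col ori (g, True). D a b)"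
  shows "\<exists>u. \<forall>(a, b)\<in>arcs n - {(j, t)}. D a b = u a + u b"
proof -
  \<comment> \<open>The value at (j, t) is replaced by that of the reverse arc, so that
    \<open>F\<close> is symmetric everywhere.\<close>
  define F where "F a b = (if (a, b) = (j, t) then D t j else D a b)" for a b
  have D_sym: "D a b = D b a" if ab: "(a, b) \<in> arcs n" "(a, b) \<noteq> (j, t)" "(a, b) \<noteq> (t, j)" for a b
  proof -
    have "(y, x) \<notin> {(t, j), (a, b)}" if "(x, y) \<in> {(t, j), (a, b)}" for x y
      using that ab tj by (auto simp: mem_arcs)
    then obtain ori where ori: "orientation n ori" "\<And>x y. (x, y) \<in> {(t, j), (a, b)} \<Longrightarrow> ori x y"
      using orientation_extend by blast
    then have ori_tj: "ori t j" and ori_ab: "ori a b"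
      by simp_all
    \<comment> \<open>Only the edge ab is reversed. The round of its colour exchanges (a, b) for (b,
      a), while the round of any other colour serves as a fixed reference value.\<close>
    define ori' where "ori' x y = (if (x, y) = (a, b) then False else if (x, y) = (b, a) then True else ori x y)" for x y
    have "ori' x y \<noteq> ori' y x" if "(x, y) \<in> arcs n" for x y
      using orientationD[OF ori(1) that] ab(1) by (auto simp: ori'_def mem_arcs)
    then have "orientation n ori'"
      unfolding orientation_def by blast
    moreover have "ori' t j"
      using ori_tj ab tj by (auto simp: ori'_def mem_arcs)
    ultimately have ori': "orientation n ori'" "ori' t j" .
    define col where "col = circle_colour n"
    have col: "one_factorization n col"
      unfolding col_def using n by (intro one_factorization_circle) auto
    define f where "f = col a b"
    define g where "g = (if f = 0 then 1 else 0 :: nat)"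
    have g: "g < n - 1" "f \<noteq> g"
      using n by (auto simp: g_def)
    have f: "f < n - 1" "col b a = f"
      using one_factorizationD(1,2)[OF col] ab by (auto simp: f_def mem_arcs)
    have same: "round_arcs n col ori' (g, True) = round_arcs n col ori (g, True)"
      using g f by (auto simp: round_arcs_def ori'_def f_def split: if_splits)
    define R where "R = round_arcs n col ori (f, True) - {(a, b)}"
    have "finite R"
      by (simp add: R_def finite_round_arcs)
    have "\<not> ori b a"
      using orientationD[OF ori(1) ab(1)] ori_ab by simp
    then have 1: "round_arcs n col ori (f, True) = insert (a, b) R" "round_arcs n col ori' (f, True) = insert (b, a) R"
      "(a, b) \<notin> R" "(b, a) \<notin> R"
      using ab f ori_ab by (auto simp: round_arcs_def ori'_def f_def R_def mem_arcs split: if_splits)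
    show ?thesis
      using const[OF col ori(1) ori_tj f(1) g] const[OF col ori' f(1) g] \<open>finite R\<close> 1(3,4)
      unfolding same 1(1,2) by simp
  qed
  have F_sym: "F a b = F b a" if "(a, b) \<in> arcs n" for a b
  proof (cases "(a, b) = (j, t) \<or> (a, b) = (t, j)")
    case True
    then show ?thesis
      using tj by (auto simp: F_def mem_arcs)
  next
    case False
    then have "D a b = D b a"
      using D_sym[OF that] by blast
    moreover have "F a b = D a b" "F b a = D b a"
      using False by (auto simp: F_def)
    ultimately show ?thesis
      by simp
  qed
  have "(y, x) \<notin> {(t, j)}" if "(x, y) \<in> {(t, j)}" for x y
    using that tj by (auto simp: mem_arcs)
  then obtain ori where ori: "orientation n ori" "\<And>x y. (x, y) \<in> {(t, j)} \<Longrightarrow> ori x y"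
    using orientation_extend by blast
  then have ori_tj: "ori t j"
    by simp
  have F_D: "(\<Sum>(a, b)\<in>round_arcs n col ori (f, True). F a b) = (\<Sum>(a, b)\<in>round_arcs n col ori (f, True). D a b)" for col f
  proof (rule sum.cong[OF refl])
    fix e
    assume "e \<in> round_arcs n col ori (f, True)"
    then have "e \<noteq> (j, t)"
      using orientationD[OF ori(1) tj] ori_tj by (auto simp: round_arcs_def)
    then show "(case e of (a, b) \<Rightarrow> F a b) = (case e of (a, b) \<Rightarrow> D a b)"
      by (cases e) (auto simp: F_def)
  qed
  have "(\<Sum>(a, b)\<in>{(a, b) \<in> arcs n. col a b = f}. F a b) = (\<Sum>(a, b)\<in>{(a, b) \<in> arcs n. col a b = g}. F a b)"
    if col: "one_factorization n col" and fg: "f < n - 1" "g < n - 1" "f \<noteq> g" for col f g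
  proof -
    have "(\<Sum>(a, b)\<in>{(a, b) \<in> arcs n. col a b = h}. F a b) = 2 * (\<Sum>(a, b)\<in>round_arcs n col ori (h, True). D a b)" for h
      unfolding F_D[symmetric] by (rule sum_round_arcs_undirected[OF col ori(1)]) (rule F_sym)
    then show ?thesis
      using const[OF col ori(1) ori_tj fg] by metis
  qed
  then have "F a b + F c d = F a c + F b d" if "{a, b, c, d} \<subseteq> teams n" "distinct [a, b, c, d]" for a b c d
    using four_cycle_relation[OF n, of F] F_sym that by blast
  then obtain u where u: "\<And>a b. (a, b) \<in> arcs n \<Longrightarrow> F a b = u a + u b"
    using four_cycle_potential[OF n(1), of F] F_sym by blast
  have "D a b = u a + u b" if "(a, b) \<in> arcs n - {(j, t)}" for a b
    using u[of a b] that by (auto simp: F_def)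
  then show ?thesis
    by blast
qed

section \<open>Weights of tournaments\<close>

definition weight :: "nat \<Rightarrow> (nat \<Rightarrow> nat \<Rightarrow> nat \<Rightarrow> real) \<Rightarrow> (nat \<times> nat \<times> nat) set \<Rightarrow> real" where
  "weight n c T = (\<Sum>p\<in>slots n. \<Sum>(a, b)\<in>arcs n. indicator T (p, a, b) * c p a b)"

lemma weight_add: "weight n (\<lambda>p a b. c p a b + d p a b) T = weight n c T + weight n d T"
  by (simp add: weight_def case_prod_beta distrib_left sum.distrib)

lemma weight_scale: "weight n (\<lambda>p a b. r * c p a b) T = r * weight n c T"
  by (simp add: weight_def case_prod_beta sum_distrib_left mult.left_commute)

lemma weight_sum: "finite I \<Longrightarrow> weight n (\<lambda>p a b. \<Sum>i\<in>I. c i p a b) T = (\<Sum>i\<in>I. weight n (c i) T)"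
proof (induction I rule: finite_induct)
  case empty
  then show ?case
    by (simp add: weight_def)
next
  case (insert i I)
  then show ?case
    by (simp add: weight_add)
qed

lemma weight_single:
  assumes "q \<in> slots n" "(x, y) \<in> arcs n"
  shows "weight n (\<lambda>p a b. of_bool ((p, a, b) = (q, x, y))) T = indicator T (q, x, y)"
proof -
  have "weight n (\<lambda>p a b. of_bool ((p, a, b) = (q, x, y))) T =
      (\<Sum>p\<in>slots n. \<Sum>e\<in>arcs n. if (x, y) = e then if q = p then indicator T (q, x, y) else 0 else 0)"
    unfolding weight_def by (intro sum.cong refl) auto
  also have "\<dots> = indicator T (q, x, y)"
    using assms by (simp add: finite_arcs finite_slots)
  finally show ?thesis .
qed

lemma weight_schedule:
  "weight n c (schedule n col ori s) = (\<Sum>p\<in>slots n. \<Sum>(a, b)\<in>round_arcs n col ori (s p). c p a b)"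
  unfolding weight_def
proof (rule sum.cong[OF refl])
  fix p
  assume "p \<in> slots n"
  then have "(\<Sum>(a, b)\<in>arcs n. indicator (schedule n col ori s) (p, a, b) * c p a b) =
      (\<Sum>(a, b)\<in>arcs n. if (a, b) \<in> round_arcs n col ori (s p) then c p a b else 0)"
    by (intro sum.cong) (auto simp: schedule_def indicator_def)
  also have "\<dots> = (\<Sum>(a, b)\<in>arcs n \<inter> round_arcs n col ori (s p). c p a b)"
    by (simp add: sum.inter_restrict finite_arcs case_prod_beta)
  also have "arcs n \<inter> round_arcs n col ori (s p) = round_arcs n col ori (s p)"
    by (auto simp: round_arcs_def)
  finally show "(\<Sum>(a, b)\<in>arcs n. indicator (schedule n col ori s) (p, a, b) * c p a b) =
      (\<Sum>(a, b)\<in>round_arcs n col ori (s p). c p a b)" .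
qed

text \<open>The two weights differ only in the terms of slots p and q. Equality gives P(s p) + Q(s
  q) = P(s q) + Q(s p), where P and Q are the sums of \<open>c p\<close> and \<open>c q\<close> over
  a round, and this rearranges to the claim.\<close>

lemma weight_swap_slots:
  assumes pq: "p \<in> slots n" "q \<in> slots n" "p \<noteq> q"
    and eq: "weight n c (schedule n col ori s) = weight n c (schedule n col ori (s(p := s q, q := s p)))"
  shows "(\<Sum>(a, b)\<in>round_arcs n col ori (s p). c p a b - c q a b) =
    (\<Sum>(a, b)\<in>round_arcs n col ori (s q). c p a b - c q a b)"
proof -
  let ?S = "\<lambda>r m. \<Sum>(a, b)\<in>round_arcs n col ori r. c m a b"
  have split: "(\<Sum>m\<in>slots n. ?S (h m) m) = (\<Sum>m\<in>slots n - {p, q}. ?S (h m) m) + (?S (h p) p + ?S (h q) q)" for h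
  proof -
    have "(\<Sum>m\<in>slots n. ?S (h m) m) = (\<Sum>m\<in>slots n - {p, q}. ?S (h m) m) + (\<Sum>m\<in>{p, q}. ?S (h m) m)"
      using pq by (intro sum.subset_diff) (auto simp: finite_slots)
    then show ?thesis
      using pq by simp
  qed
  have "(\<Sum>m\<in>slots n - {p, q}. ?S ((s(p := s q, q := s p)) m) m) = (\<Sum>m\<in>slots n - {p, q}. ?S (s m) m)"
    by (rule sum.cong) auto
  then have "?S (s p) p + ?S (s q) q = ?S (s q) p + ?S (s p) q"
    using eq split[of s] split[of "s(p := s q, q := s p)"] pq(3) unfolding weight_schedule by simp
  then show ?thesis
    by (simp add: sum_subtractf case_prod_beta)
qed

lemma bij_betw_swap_slots:
  assumes s: "bij_betw s (slots n) R" and "p \<in> slots n" "q \<in> slots n"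
  shows "bij_betw (s(p := s q, q := s p)) (slots n) R"
proof -
  have "s(p := s q, q := s p) = s \<circ> Transposition.transpose p q"
    by (auto simp: fun_eq_iff Transposition.transpose_def)
  moreover have "bij_betw (Transposition.transpose p q) (slots n) (slots n)"
    using assms by simp
  ultimately show ?thesis
    using s by (metis bij_betw_trans)
qed

text \<open>Each arc is played once, so \<open>w\<close> contributes its full sum; each team plays
  once per slot, so \<open>u\<close> contributes its full sum. Only the slot of (j, t) can still
  influence the weight.\<close>

lemma weight_potential:
  assumes T: "tournament n T" and "n \<ge> 2" and s: "(s, j, t) \<in> T"
    and c: "\<And>p a b. p \<in> slots n \<Longrightarrow> (a, b) \<in> arcs n \<Longrightarrow>
      c p a b = w a b + u p a + u p b + (if (a, b) = (j, t) then g p else 0)"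
  shows "weight n c T = (\<Sum>(a, b)\<in>arcs n. w a b) + (\<Sum>p\<in>slots n. \<Sum>a\<in>teams n. u p a) + g s"
proof -
  let ?i = "\<lambda>p a b. indicator T (p, a, b) :: real"
  have "weight n c T = (\<Sum>p\<in>slots n. \<Sum>(a, b)\<in>arcs n.
      ?i p a b * w a b + (?i p a b * u p a + ?i p a b * u p b) + ?i p a b * (if (a, b) = (j, t) then g p else 0))"
    unfolding weight_def by (intro sum.cong refl) (auto simp: c algebra_simps)
  also have "\<dots> = (\<Sum>p\<in>slots n. \<Sum>(a, b)\<in>arcs n. ?i p a b * w a b)
      + (\<Sum>p\<in>slots n. \<Sum>(a, b)\<in>arcs n. ?i p a b * u p a + ?i p a b * u p b)
      + (\<Sum>p\<in>slots n. \<Sum>(a, b)\<in>arcs n. ?i p a b * (if (a, b) = (j, t) then g p else 0))"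
    by (simp add: sum.distrib case_prod_beta)
  also have "(\<Sum>p\<in>slots n. \<Sum>(a, b)\<in>arcs n. ?i p a b * w a b) = (\<Sum>(a, b)\<in>arcs n. w a b)"
  proof -
    have "(\<Sum>p\<in>slots n. \<Sum>(a, b)\<in>arcs n. ?i p a b * w a b) = (\<Sum>e\<in>arcs n. \<Sum>p\<in>slots n. case e of (a, b) \<Rightarrow> ?i p a b * w a b)"
      by (rule sum.swap)
    also have "\<dots> = (\<Sum>(a, b)\<in>arcs n. w a b)"
      by (rule sum.cong) (auto simp: tournament_arc_sum[OF T] simp flip: sum_distrib_right)
    finally show ?thesis .
  qed
  also have "(\<Sum>p\<in>slots n. \<Sum>(a, b)\<in>arcs n. ?i p a b * u p a + ?i p a b * u p b) = (\<Sum>p\<in>slots n. \<Sum>a\<in>teams n. u p a)"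
  proof (rule sum.cong[OF refl])
    fix p
    assume p: "p \<in> slots n"
    have "(\<Sum>(a, b)\<in>arcs n. ?i p a b * u p a + ?i p a b * u p b) =
        (\<Sum>(a, b)\<in>arcs n. ?i p a b * u p a) + (\<Sum>(a, b)\<in>arcs n. ?i p a b * u p b)"
      by (simp add: sum.distrib case_prod_beta)
    also have "(\<Sum>(a, b)\<in>arcs n. ?i p a b * u p b) = (\<Sum>(a, b)\<in>arcs n. ?i p b a * u p a)"
      by (rule sum_arcs_flip)
    also have "(\<Sum>(a, b)\<in>arcs n. ?i p a b * u p a) + (\<Sum>(a, b)\<in>arcs n. ?i p b a * u p a) =
        (\<Sum>(a, b)\<in>arcs n. (?i p a b + ?i p b a) * u p a)"
      by (simp add: sum.distrib case_prod_beta distrib_right)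
    also have "\<dots> = (\<Sum>a\<in>teams n. (\<Sum>b\<in>teams n - {a}. ?i p a b + ?i p b a) * u p a)"
      unfolding sum_arcs sum_distrib_right ..
    also have "\<dots> = (\<Sum>a\<in>teams n. u p a)"
      by (intro sum.cong refl) (simp only: tournament_degree[OF T \<open>n \<ge> 2\<close> p] mult_1)
    finally show "(\<Sum>(a, b)\<in>arcs n. ?i p a b * u p a + ?i p a b * u p b) = (\<Sum>a\<in>teams n. u p a)" .
  qed
  also have "(\<Sum>p\<in>slots n. \<Sum>(a, b)\<in>arcs n. ?i p a b * (if (a, b) = (j, t) then g p else 0)) = g s"
  proof -
    note mem = tournament_mem[OF T s]
    have "(\<Sum>(a, b)\<in>arcs n. ?i p a b * (if (a, b) = (j, t) then g p else 0)) = ?i p j t * g p" for p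
    proof -
      have "(\<Sum>(a, b)\<in>arcs n. ?i p a b * (if (a, b) = (j, t) then g p else 0)) =
          (\<Sum>e\<in>arcs n. if (j, t) = e then ?i p j t * g p else 0)"
        by (rule sum.cong) (auto split: if_splits)
      then show ?thesis
        using mem by (simp add: finite_arcs mem_arcs)
    qed
    then have "(\<Sum>p\<in>slots n. \<Sum>(a, b)\<in>arcs n. ?i p a b * (if (a, b) = (j, t) then g p else 0)) = (\<Sum>p\<in>slots n. ?i p j t * g p)"
      by simp
    also have "\<dots> = (\<Sum>p\<in>slots n. if s = p then g p else 0)"
    proof (rule sum.cong[OF refl])
      fix p
      have "(p, j, t) \<in> T \<longleftrightarrow> s = p"
        using tournament_slot_unique[OF T s] s by blast
      then show "?i p j t * g p = (if s = p then g p else 0)"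
        by (simp add: indicator_def)
    qed
    also have "\<dots> = g s"
      using mem by (simp add: finite_slots)
    finally show ?thesis .
  qed
  finally show ?thesis .
qed

section \<open>Tournaments with prescribed matches\<close>

text \<open>The second and third arcs share exactly one team, so they have different colours in
  every one-factorization and can both lie in rounds marked \<open>False\<close>. The first arc lies
  in a round marked \<open>True\<close>, hence in a third round whatever its colour.\<close>

lemma tournament_with_three_matches:
  assumes n: "n \<ge> 4" "even n"
    and p: "{p1, p2, p3} \<subseteq> slots n" "distinct [p1, p2, p3]"
    and e: "(a1, b1) \<in> arcs n" "(a2, b2) \<in> arcs n" "(a3, b3) \<in> arcs n"
    and ne: "(a1, b1) \<noteq> (a2, b2)" "(a1, b1) \<noteq> (a3, b3)"
    and meet: "{a2, b2} \<inter> {a3, b3} \<noteq> {}" "{a2, b2} \<noteq> {a3, b3}"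
  obtains T where "tournament n T" "(p1, a1, b1) \<in> T" "(p2, a2, b2) \<in> T" "(p3, a3, b3) \<in> T"
proof -
  define col where "col = circle_colour n"
  have col: "one_factorization n col"
    unfolding col_def using n by (intro one_factorization_circle) auto
  have colne: "col a2 b2 \<noteq> col a3 b3" and ne23: "(a2, b2) \<noteq> (a3, b3)" "(a2, b2) \<noteq> (b3, a3)"
  proof -
    consider "a2 = a3" "b2 \<noteq> b3" | "a2 = b3" "b2 \<noteq> a3" | "b2 = a3" "a2 \<noteq> b3" | "b2 = b3" "a2 \<noteq> a3"
      using meet by blast
    then have "col a2 b2 \<noteq> col a3 b3 \<and> (a2, b2) \<noteq> (a3, b3) \<and> (a2, b2) \<noteq> (b3, a3)"
    proof cases
      case 1
      then show ?thesis
        using one_factorizationD(3)[OF col, of a3 b3 b2] e by (auto simp: mem_arcs)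
    next
      case 2
      then show ?thesis
        using one_factorizationD(1)[OF col, of a3 b3] one_factorizationD(3)[OF col, of b3 a3 b2] e by (auto simp: mem_arcs)
    next
      case 3
      then show ?thesis
        using one_factorizationD(1)[OF col, of a2 b2] one_factorizationD(3)[OF col, of b2 a2 b3] e by (auto simp: mem_arcs)
    next
      case 4
      then show ?thesis
        using one_factorizationD(1)[OF col, of a2 b2] one_factorizationD(1)[OF col, of a3 b3]
          one_factorizationD(3)[OF col, of b2 a2 a3] e by (auto simp: mem_arcs)
    qed
    then show "col a2 b2 \<noteq> col a3 b3" "(a2, b2) \<noteq> (a3, b3)" "(a2, b2) \<noteq> (b3, a3)"
      by auto
  qed
  \<comment> \<open>The first arc is directed as given and the other two are reversed; the assumed
    inequalities between the arcs exclude contradictory directions.\<close>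
  have "(y, x) \<notin> {(a1, b1), (b2, a2), (b3, a3)}" if "(x, y) \<in> {(a1, b1), (b2, a2), (b3, a3)}" for x y
    using that e ne ne23 by (auto simp: mem_arcs)
  then obtain ori where ori: "orientation n ori" "\<And>x y. (x, y) \<in> {(a1, b1), (b2, a2), (b3, a3)} \<Longrightarrow> ori x y"
    using orientation_extend by blast
  have ori': "ori a1 b1" "\<not> ori a2 b2" "\<not> ori a3 b3"
    using ori(2) orientationD[OF ori(1)] e by auto
  define g where "g p = (if p = p1 then (col a1 b1, True) else if p = p2 then (col a2 b2, False) else (col a3 b3, False))" for p
  have g: "g p1 = (col a1 b1, True)" "g p2 = (col a2 b2, False)" "g p3 = (col a3 b3, False)"
    using p(2) by (auto simp: g_def)
  have inj: "inj_on g {p1, p2, p3}"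
    using colne unfolding inj_on_def ball_simps g by auto
  have sub: "g ` {p1, p2, p3} \<subseteq> rounds n"
    using one_factorizationD(2)[OF col] e by (auto simp: g mem_arcs)
  have "n \<ge> 1"
    using n by simp
  obtain s where s: "bij_betw s (slots n) (rounds n)" "\<And>p. p \<in> {p1, p2, p3} \<Longrightarrow> s p = g p"
    using slot_assignment_extend[OF \<open>n \<ge> 1\<close> p(1) inj sub] by blast
  show ?thesis
  proof (rule that)
    show "tournament n (schedule n col ori s)"
      by (rule tournament_schedule[OF col ori(1) s(1)])
    show "(p1, a1, b1) \<in> schedule n col ori s" "(p2, a2, b2) \<in> schedule n col ori s" "(p3, a3, b3) \<in> schedule n col ori s"
      using s(2) g p(1) e ori' by (auto simp: mem_schedule)
  qed
qed

text \<open>An auxiliary third match is added in a spare slot: a2 at home to a team x outside the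
  second arc. Choosing x different from b1 keeps it distinct from the first arc.\<close>

lemma tournament_with_two_matches:
  assumes n: "n \<ge> 4" "even n"
    and p: "p1 \<in> slots n" "p2 \<in> slots n" "p1 \<noteq> p2"
    and e: "(a1, b1) \<in> arcs n" "(a2, b2) \<in> arcs n" "(a1, b1) \<noteq> (a2, b2)"
  obtains T where "tournament n T" "(p1, a1, b1) \<in> T" "(p2, a2, b2) \<in> T"
proof -
  have "\<exists>r\<in>{1, 2, 3::nat}. r \<noteq> p1 \<and> r \<noteq> p2"
    by auto
  then obtain r where r: "r \<in> {1, 2, 3}" "r \<noteq> p1" "r \<noteq> p2"
    by blast
  then have "r \<in> slots n"
    using n(1) by (auto simp: slots_def)
  obtain x where x: "x \<in> teams n" "x \<noteq> a2" "x \<noteq> b2" "x \<noteq> b1"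
    using ex_team_avoiding_three[OF n(1)] .
  show ?thesis
  proof (rule tournament_with_three_matches[OF n, of p1 p2 r a1 b1 a2 b2 a2 x])
    show "{p1, p2, r} \<subseteq> slots n" "distinct [p1, p2, r]"
      using p r \<open>r \<in> slots n\<close> by auto
    show "(a2, x) \<in> arcs n" "(a1, b1) \<noteq> (a2, x)" "{a2, b2} \<inter> {a2, x} \<noteq> {}" "{a2, b2} \<noteq> {a2, x}"
      using x e by (auto simp: mem_arcs)
  qed (use e that in auto)
qed

section \<open>The inequality\<close>

locale travel_inequality =
  fixes n k t j :: nat
  assumes n4: "n \<ge> 4" and even_n: "even n"
    and k_slot: "k \<in> slots n - {2 * n - 2}"
    and tj: "(t, j) \<in> arcs n"
begin

definition lhs :: "(nat \<times> nat \<times> nat) set \<Rightarrow> real" where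
  "lhs T = indicator T (1, j, t) + indicator T (k, j, t) + (\<Sum>i\<in>teams n - {t}. indicator T (k, t, i))
     + indicator T (k + 1, j, t) - 1"

text \<open>Says that \<open>lhs T\<close> is an admissible value for y(t, t, j): it is 0 or 1 and
  at least the travel indicator.\<close>

definition tight :: "(nat \<times> nat \<times> nat) set \<Rightarrow> bool" where
  "tight T \<longleftrightarrow> tournament n T \<and> (lhs T = 1 \<or> lhs T = 0 \<and> \<not> travels n T t t j)"

lemma n2: "n \<ge> 2"
  using n4 by simp

lemma tj_facts: "t \<in> teams n" "j \<in> teams n" "t \<noteq> j" "j \<noteq> t" "(j, t) \<in> arcs n"
  using tj by (auto simp: mem_arcs)

lemma k_facts: "k \<ge> 1" "k \<in> slots n" "k + 1 \<in> slots n" "1 \<in> slots n" "1 \<noteq> k + 1" "k \<noteq> k + 1"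
  using k_slot n4 by (auto simp: slots_def)

section \<open>Validity and tightness in terms of the slot of (j, t)\<close>

lemma lhs_eq:
  assumes T: "tournament n T" and s: "(s, j, t) \<in> T"
  shows "lhs T = of_bool (s = 1) + of_bool (s = k) + of_bool (\<exists>a. (k, t, a) \<in> T) + of_bool (s = k + 1) - 1"
proof -
  have "(p, j, t) \<in> T \<longleftrightarrow> s = p" for p
    using tournament_slot_unique[OF T s] s by blast
  then have "indicator T (p, j, t) = (of_bool (s = p) :: real)" for p
    by (simp add: indicator_def)
  then show ?thesis
    by (simp only: lhs_def tournament_home_sum[OF T n2 k_facts(2) tj_facts(1)])
qed

text \<open>Team t is at venue j only in slot s, so it travels there from home exactly if it is at
  home just before. For s = 1 the preceding position is the start, where t is at home.\<close>

lemma travels_iff: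
  assumes T: "tournament n T" and s: "(s, j, t) \<in> T"
  shows "travels n T t t j \<longleftrightarrow> s = 1 \<or> (\<exists>a. (s - 1, t, a) \<in> T)"
proof
  assume "travels n T t t j"
  then obtain p where p: "p + 1 \<in> slots n" "(p + 1, j, t) \<in> T" "at_venue n T t p t"
    using travels_to_away tj_facts by metis
  then have "s = p + 1"
    using tournament_slot_unique[OF T s] by blast
  show "s = 1 \<or> (\<exists>a. (s - 1, t, a) \<in> T)"
  proof (cases "p = 0")
    case False
    then have "p \<in> slots n"
      using p(1) by (auto simp: slots_def)
    then show ?thesis
      using at_home_iff[OF T] p(3) \<open>s = p + 1\<close> by auto
  qed (use \<open>s = p + 1\<close> in simp)
next
  assume *: "s = 1 \<or> (\<exists>a. (s - 1, t, a) \<in> T)"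
  have s_slot: "s \<in> slots n"
    using tournament_mem(1)[OF T s] .
  have "at_venue n T t (s - 1) t"
  proof (cases "s = 1")
    case True
    then show ?thesis
      by (simp add: at_venue_def slots_def)
  next
    case False
    then obtain a where "(s - 1, t, a) \<in> T"
      using * by blast
    then show ?thesis
      using at_home_iff[OF T] tournament_mem(1)[OF T] by blast
  qed
  moreover have "at_venue n T t (s - 1 + 1) j" "s - 1 \<in> {0..2 * n - 2}"
    using s s_slot by (auto simp: at_venue_def slots_def)
  ultimately show "travels n T t t j"
    using tj_facts(3) unfolding travels_def by blast
qed

lemma not_home_if_away: "tournament n T \<Longrightarrow> (p, a, t) \<in> T \<Longrightarrow> \<not> (\<exists>b. (p, t, b) \<in> T)"
  using tournament_home_away n2 by blast

text \<open>Positive \<open>lhs\<close> needs two of its terms to be 1. As s = k excludes a home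
  match of t in slot k, this leaves s = 1, or s = k + 1 with t at home in slot k; in both cases t
  travels from home to j.\<close>

lemma lhs_le_travels:
  assumes T: "tournament n T"
  shows "lhs T \<le> of_bool (travels n T t t j)"
proof -
  obtain s where s: "(s, j, t) \<in> T"
    using tournament_arc_ex1[OF T tj_facts(5)] by blast
  have "s = k \<Longrightarrow> \<not> (\<exists>a. (k, t, a) \<in> T)"
    using not_home_if_away[OF T s] by simp
  then show ?thesis
    using k_facts(1) unfolding lhs_eq[OF T s] travels_iff[OF T s] by (auto simp: of_bool_def)
qed

text \<open>For s = k + 1, \<open>lhs\<close> and the travel indicator both reduce to whether t
  plays at home in slot k.\<close>

lemma tight_next:
  assumes T: "tournament n T" and s: "(k + 1, j, t) \<in> T"
  shows "tight T"
  using k_facts(1) unfolding tight_def lhs_eq[OF T s] travels_iff[OF T s]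
  by (auto simp: T of_bool_def)

text \<open>Here \<open>lhs\<close> is 1: for k = 1 the match (j, t) is counted twice, otherwise
  once together with the home match in slot k.\<close>

lemma tight_first:
  assumes T: "tournament n T" and s: "(1, j, t) \<in> T" and "k = 1 \<or> (k, t, a) \<in> T"
  shows "tight T"
  using assms(3) k_facts(1) not_home_if_away[OF T s] unfolding tight_def lhs_eq[OF T s] travels_iff[OF T s]
  by (auto simp: T of_bool_def)

text \<open>Here \<open>lhs\<close> is 0, and t comes to j from an away match.\<close>

lemma tight_same:
  assumes T: "tournament n T" and s: "(k, j, t) \<in> T" and "k \<noteq> 1" and a: "(k - 1, a, t) \<in> T"
  shows "tight T"
  using assms(3) k_facts(1) not_home_if_away[OF T s] not_home_if_away[OF T a]
  unfolding tight_def lhs_eq[OF T s] travels_iff[OF T s]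
  by (auto simp: T of_bool_def)

text \<open>The home match in slot k raises \<open>lhs\<close> to 0, and t comes to j from an away
  match.\<close>

lemma tight_other:
  assumes T: "tournament n T" and s: "(s, j, t) \<in> T" and "s \<notin> {1, k, k + 1}"
    and b: "(k, t, b) \<in> T" and a: "(s - 1, a, t) \<in> T"
  shows "tight T"
  using assms(3) b not_home_if_away[OF T a]
  unfolding tight_def lhs_eq[OF T s] travels_iff[OF T s]
  by (auto simp: T of_bool_def)

section \<open>Existence of tight tournaments\<close>

lemma ex_two_opponents:
  obtains x y where "x \<in> teams n" "y \<in> teams n" "x \<noteq> y" "x \<noteq> t" "y \<noteq> t" "x \<noteq> j" "y \<noteq> j"
    "(x, t) \<in> arcs n" "(t, x) \<in> arcs n" "(t, y) \<in> arcs n"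
proof -
  obtain x where x: "x \<in> teams n" "x \<noteq> t" "x \<noteq> j" "x \<noteq> j"
    using ex_team_avoiding_three[OF n4] .
  obtain y where y: "y \<in> teams n" "y \<noteq> t" "y \<noteq> j" "y \<noteq> x"
    using ex_team_avoiding_three[OF n4] .
  show ?thesis
    using that[of x y] x y tj_facts(1) by (auto simp: mem_arcs)
qed

text \<open>Each position of s relative to 1, k and k + 1 has its own sufficient condition for
  tightness, which prescribes at most three matches.\<close>

lemma ex_tight:
  assumes "s \<in> slots n"
  obtains T where "tight T" "(s, j, t) \<in> T"
proof -
  obtain x y where xy: "x \<in> teams n" "y \<in> teams n" "x \<noteq> y" "x \<noteq> t" "y \<noteq> t" "x \<noteq> j" "y \<noteq> j"
    "(x, t) \<in> arcs n" "(t, x) \<in> arcs n" "(t, y) \<in> arcs n"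
    by (rule ex_two_opponents)
  have ne: "(j, t) \<noteq> (x, t)" "(j, t) \<noteq> (t, x)" "(j, t) \<noteq> (t, y)"
    using xy tj_facts by auto
  note two = tournament_with_two_matches[OF n4 even_n]
  consider "s = k + 1" | "s = 1" "k \<noteq> 1" | "s = 1" "k = 1" | "s = k" "k \<noteq> 1" | "s \<notin> {1, k, k + 1}"
    by blast
  then show ?thesis
  proof cases
    case 1
    obtain T where "tournament n T" "(k + 1, j, t) \<in> T" "(1, x, t) \<in> T"
      by (rule two[OF k_facts(3,4) k_facts(5)[symmetric] tj_facts(5) xy(8) ne(1)])
    then show ?thesis
      using that tight_next 1 by blast
  next
    case 2
    obtain T where "tournament n T" "(1, j, t) \<in> T" "(k, t, x) \<in> T"
      by (rule two[OF k_facts(4,2) 2(2)[symmetric] tj_facts(5) xy(9) ne(2)])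
    then show ?thesis
      using that tight_first 2 by blast
  next
    case 3
    obtain T where "tournament n T" "(1, j, t) \<in> T" "(k + 1, x, t) \<in> T"
      by (rule two[OF k_facts(4,3,5) tj_facts(5) xy(8) ne(1)])
    then show ?thesis
      using that tight_first 3 by blast
  next
    case 4
    have k1: "k - 1 \<in> slots n" "k \<noteq> k - 1"
      using 4 k_facts(1,2) by (auto simp: slots_def)
    obtain T where "tournament n T" "(k, j, t) \<in> T" "(k - 1, x, t) \<in> T"
      by (rule two[OF k_facts(2) k1 tj_facts(5) xy(8) ne(1)])
    then show ?thesis
      using that tight_same 4 by blast
  next
    case 5
    \<comment> \<open>As s is neither 1 nor k + 1, s - 1 is a slot different from k.\<close>
    have sk: "{s, k, s - 1} \<subseteq> slots n" "distinct [s, k, s - 1]"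
      using assms 5 k_facts(2) by (auto simp: slots_def)
    have meet: "{t, y} \<inter> {x, t} \<noteq> {}" "{t, y} \<noteq> {x, t}"
      using xy by auto
    obtain T where "tournament n T" "(s, j, t) \<in> T" "(k, t, y) \<in> T" "(s - 1, x, t) \<in> T"
      by (rule tournament_with_three_matches[OF n4 even_n sk tj_facts(5) xy(10,8) ne(3,1) meet])
    then show ?thesis
      using that tight_other 5 by blast
  qed
qed

text \<open>Over such a tournament y(v, a, b) can be raised from 0 to 1 without leaving the face.
  The cases prescribe where v is just before reaching b or just after leaving a.\<close>

lemma ex_tight_not_travelling:
  assumes v: "v \<in> teams n" "(a, b) \<in> arcs n" "(v, a, b) \<noteq> (t, t, j)"
  obtains T where "tight T" "\<not> travels n T v a b"
proof -
  note two = tournament_with_two_matches[OF n4 even_n]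
  note three = tournament_with_three_matches[OF n4 even_n]
  have ab: "a \<in> teams n" "b \<in> teams n" "a \<noteq> b"
    using v by (auto simp: mem_arcs)
  \<comment> \<open>The first slot of two consecutive ones that avoid k + 1, which is reserved for
    (j, t).\<close>
  define q where "q = (if k = 1 then 3 else 1 :: nat)"
  have q: "{k + 1, q, q + 1} \<subseteq> slots n" "distinct [k + 1, q, q + 1]"
    using n4 k_facts(1,3) by (auto simp: q_def slots_def)
  consider "a = v" | "b = v" "(a, v) \<noteq> (j, t)" | "b = v" "(a, v) = (j, t)" "k + 2 \<in> slots n"
    | "b = v" "(a, v) = (j, t)" "k + 2 \<notin> slots n" | "a \<noteq> v" "b \<noteq> v" "(b, v) \<noteq> (j, t)" | "a \<noteq> v" "(b, v) = (j, t)"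
    by blast
  then show ?thesis
  proof cases
    case 1
    \<comment> \<open>Team v visits x directly before b, so it does not reach b from home.\<close>
    obtain x where x: "x \<in> teams n" "x \<noteq> v" "x \<noteq> b" "x \<noteq> j"
      using ex_team_avoiding_three[OF n4] .
    have arcs: "(x, v) \<in> arcs n" "(b, v) \<in> arcs n"
      using x v ab 1 by (auto simp: mem_arcs)
    have ne: "(j, t) \<noteq> (x, v)" "(j, t) \<noteq> (b, v)"
      using x v(3) 1 by auto
    have meet: "{x, v} \<inter> {b, v} \<noteq> {}" "{x, v} \<noteq> {b, v}"
      using x by auto
    obtain T where T: "tournament n T" "(k + 1, j, t) \<in> T" "(q, x, v) \<in> T" "(q + 1, b, v) \<in> T"
      by (rule three[OF q tj_facts(5) arcs ne meet])
    have "\<not> travels n T v a b"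
    proof
      assume "travels n T v a b"
      moreover have "b \<noteq> v"
        using 1 ab by simp
      ultimately obtain p where p: "(p + 1, b, v) \<in> T" "at_venue n T v p a"
        using travels_to_away by metis
      have "p + 1 = q + 1"
        using tournament_slot_unique[OF T(1) p(1) T(4)] .
      then have "at_venue n T v q v"
        using p(2) 1 by simp
      then obtain y where "(q, v, y) \<in> T"
        using at_home_iff[OF T(1)] q(1) by auto
      then show False
        using tournament_home_away[OF T(1) n2] T(3) by blast
    qed
    then show ?thesis
      using that tight_next[OF T(1,2)] by blast
  next
    case 2
    \<comment> \<open>Team v visits x directly after a, so it does not return home from
      there.\<close>
    obtain x where x: "x \<in> teams n" "x \<noteq> v" "x \<noteq> a" "x \<noteq> j"
      using ex_team_avoiding_three[OF n4] .
    have arcs: "(a, v) \<in> arcs n" "(x, v) \<in> arcs n"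
      using x v ab 2 by (auto simp: mem_arcs)
    have ne: "(j, t) \<noteq> (a, v)" "(j, t) \<noteq> (x, v)"
      using x 2 by auto
    have meet: "{a, v} \<inter> {x, v} \<noteq> {}" "{a, v} \<noteq> {x, v}"
      using x by auto
    obtain T where T: "tournament n T" "(k + 1, j, t) \<in> T" "(q, a, v) \<in> T" "(q + 1, x, v) \<in> T"
      by (rule three[OF q tj_facts(5) arcs ne meet])
    have "\<not> travels n T v a b"
    proof
      assume "travels n T v a b"
      moreover have "a \<noteq> v"
        using 2 ab by simp
      ultimately obtain p where p: "(p, a, v) \<in> T" "at_venue n T v (p + 1) b"
        using travels_from_away by metis
      have "p = q"
        using tournament_slot_unique[OF T(1) p(1) T(3)] .
      then have "at_venue n T v (q + 1) v"
        using p(2) 2 by simp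
      then obtain y where "(q + 1, v, y) \<in> T"
        using at_home_iff[OF T(1), of "q + 1"] q(1) by auto
      then show False
        using tournament_home_away[OF T(1) n2] T(4) by blast
    qed
    then show ?thesis
      using that tight_next[OF T(1,2)] by blast
  next
    case 3
    \<comment> \<open>Team t visits x directly after j, so it does not return home from
      there.\<close>
    obtain x y where xy: "x \<in> teams n" "y \<in> teams n" "x \<noteq> y" "x \<noteq> t" "y \<noteq> t" "x \<noteq> j" "y \<noteq> j"
      "(x, t) \<in> arcs n" "(t, x) \<in> arcs n" "(t, y) \<in> arcs n"
      by (rule ex_two_opponents)
    have ne: "k + 1 \<noteq> k + 2" "(j, t) \<noteq> (x, t)"
      using xy by auto
    obtain T where T: "tournament n T" "(k + 1, j, t) \<in> T" "(k + 2, x, t) \<in> T"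
      by (rule two[OF k_facts(3) 3(3) ne(1) tj_facts(5) xy(8) ne(2)])
    have "\<not> travels n T v a b"
    proof
      assume "travels n T v a b"
      moreover have "a \<noteq> v"
        using 3 ab by simp
      ultimately obtain p where p: "(p, a, v) \<in> T" "at_venue n T v (p + 1) b"
        using travels_from_away by metis
      then have "(p, j, t) \<in> T"
        using 3(2) by simp
      then have "p = k + 1"
        using tournament_slot_unique[OF T(1) _ T(2)] by blast
      then have "at_venue n T t (k + 2) t"
        using p(2) 3 by simp
      then obtain y where "(k + 2, t, y) \<in> T"
        using at_home_iff[OF T(1) 3(3)] by auto
      then show False
        using tournament_home_away[OF T(1) n2] T(3) by blast
    qed
    then show ?thesis
      using that tight_next[OF T(1,2)] by blast
  next
    case 4
    \<comment> \<open>Slot k + 1 is the last one, after which t would return home. So (j, t) is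
      moved to slot 1 with a visit to x next; the home match in slot k makes this tight.\<close>
    obtain x y where xy: "x \<in> teams n" "y \<in> teams n" "x \<noteq> y" "x \<noteq> t" "y \<noteq> t" "x \<noteq> j" "y \<noteq> j"
      "(x, t) \<in> arcs n" "(t, x) \<in> arcs n" "(t, y) \<in> arcs n"
      by (rule ex_two_opponents)
    have ne: "(j, t) \<noteq> (x, t)" "(j, t) \<noteq> (t, y)"
      using xy tj_facts by auto
    have meet: "{x, t} \<inter> {t, y} \<noteq> {}" "{x, t} \<noteq> {t, y}"
      using xy by auto
    have slots12: "{1, 2, k} \<subseteq> slots n" "distinct [1, 2, k]"
      using 4(3) k_facts(2) n4 by (auto simp: slots_def)
    obtain T where T: "tournament n T" "(1, j, t) \<in> T" "(2, x, t) \<in> T" "(k, t, y) \<in> T"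
      by (rule three[OF slots12 tj_facts(5) xy(8,10) ne meet])
    have "\<not> travels n T v a b"
    proof
      assume "travels n T v a b"
      moreover have "a \<noteq> v"
        using 4 ab by simp
      ultimately obtain p where p: "(p, a, v) \<in> T" "at_venue n T v (p + 1) b"
        using travels_from_away by metis
      then have "(p, j, t) \<in> T"
        using 4(2) by simp
      then have "p = 1"
        using tournament_slot_unique[OF T(1) _ T(2)] by blast
      then have "at_venue n T t 2 t"
        using p(2) 4 by (simp add: numeral_2_eq_2)
      then obtain y where "(2, t, y) \<in> T"
        using at_home_iff[OF T(1), of 2] slots12 by auto
      then show False
        using tournament_home_away[OF T(1) n2] T(3) by blast
    qed
    then show ?thesis
      using that tight_first[OF T(1,2)] T(4) by blast
  next
    case 5
    \<comment> \<open>With (b, v) in slot 1, team v reaches b from its own venue and not from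
      a.\<close>
    have bv: "(b, v) \<in> arcs n"
      using v ab 5 by (auto simp: mem_arcs)
    obtain T where T: "tournament n T" "(k + 1, j, t) \<in> T" "(1, b, v) \<in> T"
      by (rule two[OF k_facts(3,4) k_facts(5)[symmetric] tj_facts(5) bv 5(3)[symmetric]])
    have "\<not> travels n T v a b"
    proof
      assume "travels n T v a b"
      then obtain p where p: "(p + 1, b, v) \<in> T" "at_venue n T v p a"
        using travels_to_away 5(2) by metis
      have "p + 1 = 1"
        using tournament_slot_unique[OF T(1) p(1) T(3)] .
      then show False
        using p(2) 5(1) by (simp add: at_venue_def slots_def)
    qed
    then show ?thesis
      using that tight_next[OF T(1,2)] by blast
  next
    case 6
    \<comment> \<open>A tight tournament with (j, t) in slot 1 lets t reach j from home and not from
      a.\<close>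
    obtain T where T: "tight T" "(1, j, t) \<in> T"
      using ex_tight[OF k_facts(4)] .
    have "\<not> travels n T v a b"
    proof
      assume "travels n T v a b"
      moreover have "b \<noteq> v"
        using 6 tj_facts by auto
      ultimately obtain p where p: "(p + 1, b, v) \<in> T" "at_venue n T v p a"
        using travels_to_away by metis
      then have "(p + 1, j, t) \<in> T"
        using 6(2) by simp
      then have "p + 1 = 1"
        using tournament_slot_unique[OF _ _ T(2)] T(1) unfolding tight_def by blast
      then show False
        using p(2) 6(1) by (simp add: at_venue_def slots_def)
    qed
    then show ?thesis
      using that T by blast
  qed
qed

section \<open>Exchanging two slots of a tight schedule\<close>

text \<open>If a schedule stays tight when slots p and q exchange their rounds, its weight is
  unchanged, so c p - c q has the same sum over both rounds. Having this for all pairs of rounds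
  marked \<open>True\<close> with different colours is the hypothesis of
  \<open>rounds_potential\<close>.\<close>

lemma exchange_potential:
  assumes pq: "p \<in> slots n" "q \<in> slots n" "p \<noteq> q"
    and const: "\<And>T. tight T \<Longrightarrow> weight n c T = \<delta>"
    and tight: "\<And>col ori f g. one_factorization n col \<Longrightarrow> orientation n ori \<Longrightarrow> ori t j \<Longrightarrow>
      f < n - 1 \<Longrightarrow> g < n - 1 \<Longrightarrow> f \<noteq> g \<Longrightarrow>
      \<exists>s. bij_betw s (slots n) (rounds n) \<and> s p = (f, True) \<and> s q = (g, True) \<and>
        tight (schedule n col ori s) \<and> tight (schedule n col ori (s(p := s q, q := s p)))"
  shows "\<exists>u. \<forall>(a, b)\<in>arcs n - {(j, t)}. c p a b - c q a b = u a + u b"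
proof (rule rounds_potential[OF n4 even_n tj])
  fix col ori f g
  assume *: "one_factorization n col" "orientation n ori" "ori t j" "f < n - 1" "g < n - 1" "f \<noteq> g"
  obtain s where s: "s p = (f, True)" "s q = (g, True)"
    "tight (schedule n col ori s)" "tight (schedule n col ori (s(p := s q, q := s p)))"
    using tight[OF *] by blast
  have "weight n c (schedule n col ori s) = weight n c (schedule n col ori (s(p := s q, q := s p)))"
    unfolding const[OF s(3)] const[OF s(4)] ..
  from weight_swap_slots[OF pq this]
  show "(\<Sum>(a, b)\<in>round_arcs n col ori (f, True). c p a b - c q a b) =
      (\<Sum>(a, b)\<in>round_arcs n col ori (g, True). c p a b - c q a b)"
    unfolding s(1,2) .
qed

text \<open>As \<open>ori t j\<close> holds, (j, t) lies in a round marked \<open>False\<close>,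
  distinct from the two being exchanged. It is fixed in slot k + 1, which ensures tightness before
  and after.\<close>

lemma potential_away_from_next:
  assumes pq: "p \<in> slots n" "q \<in> slots n" "p \<noteq> q" "p \<noteq> k + 1" "q \<noteq> k + 1"
    and const: "\<And>T. tight T \<Longrightarrow> weight n c T = \<delta>"
  shows "\<exists>u. \<forall>(a, b)\<in>arcs n - {(j, t)}. c p a b - c q a b = u a + u b"
proof (rule exchange_potential[OF pq(1-3) const])
  fix col ori f g
  assume col: "one_factorization n col" and ori: "orientation n ori" "ori t j"
    and fg: "f < n - 1" "g < n - 1" "f \<noteq> g"
  define h where "h m = (if m = p then (f, True) else if m = q then (g, True) else (col j t, False))" for m
  have h: "h p = (f, True)" "h q = (g, True)" "h (k + 1) = (col j t, False)"
    using pq by (auto simp: h_def)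
  have "inj_on h {p, q, k + 1}"
    using fg unfolding inj_on_def ball_simps h by auto
  moreover have "h ` {p, q, k + 1} \<subseteq> rounds n"
    using fg one_factorizationD(2)[OF col tj_facts(2,1,4)] unfolding image_insert h by auto
  moreover have "{p, q, k + 1} \<subseteq> slots n" "n \<ge> 1"
    using pq k_facts n4 by auto
  ultimately obtain s where s: "bij_betw s (slots n) (rounds n)" "\<And>m. m \<in> {p, q, k + 1} \<Longrightarrow> s m = h m"
    using slot_assignment_extend by metis
  have sv: "s p = (f, True)" "s q = (g, True)" "s (k + 1) = (col j t, False)"
    using s(2) h by auto
  have "\<not> ori j t"
    using orientationD[OF ori(1) tj] ori(2) by simp
  then have mem: "(k + 1, j, t) \<in> schedule n col ori s'" if "s' (k + 1) = (col j t, False)" for s'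
    using that k_facts tj_facts by (simp add: mem_schedule)
  have "tight (schedule n col ori s)"
    by (rule tight_next[OF tournament_schedule[OF col ori(1) s(1)] mem[of s, OF sv(3)]])
  moreover have "tight (schedule n col ori (s(p := s q, q := s p)))"
    by (rule tight_next[OF tournament_schedule[OF col ori(1) bij_betw_swap_slots[OF s(1) pq(1,2)]] mem])
      (use sv(3) pq in simp)
  ultimately show "\<exists>s. bij_betw s (slots n) (rounds n) \<and> s p = (f, True) \<and> s q = (g, True) \<and>
        tight (schedule n col ori s) \<and> tight (schedule n col ori (s(p := s q, q := s p)))"
    using s(1) sv(1,2) by blast
qed

text \<open>Slot k + 1 takes part in the exchange, so tightness is secured by (j, t) in slot 1 and,
  unless k = 1, a home match of t in slot k. The slot q avoids both so that they survive the
  exchange.\<close>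

lemma potential_next:
  assumes q: "q \<in> slots n" "q \<notin> {1, k, k + 1}"
    and const: "\<And>T. tight T \<Longrightarrow> weight n c T = \<delta>"
  shows "\<exists>u. \<forall>(a, b)\<in>arcs n - {(j, t)}. c (k + 1) a b - c q a b = u a + u b"
proof -
  have "k + 1 \<noteq> q"
    using q by auto
  show ?thesis
  proof (rule exchange_potential[OF k_facts(3) q(1) \<open>k + 1 \<noteq> q\<close> const])
    fix col ori f g
    assume col: "one_factorization n col" and ori: "orientation n ori" "ori t j"
      and fg: "f < n - 1" "g < n - 1" "f \<noteq> g"
    have not_ori: "\<not> ori j t"
      using orientationD[OF ori(1) tj] ori(2) by simp
    have cj: "col j t < n - 1" "col t j = col j t"
      using one_factorizationD(1,2)[OF col tj_facts(2,1,4)] by auto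
    \<comment> \<open>The round for slot k must have t at home and differ from the three other fixed
      rounds. If jt has colour f or g, one of the colours 0, 1, 2 is different from both and hence
      from that of jt; otherwise the reverse match (t, j) itself is suitable.\<close>
    obtain r m where r: "r < n - 1" "m \<in> teams n" "m \<noteq> t" "col t m = r"
      "(r, ori t m) \<notin> {(f, True), (g, True), (col j t, False)}"
    proof (cases "col j t \<in> {f, g}")
      case True
      have "\<exists>r\<in>{0, 1, 2::nat}. r \<noteq> f \<and> r \<noteq> g"
        by auto
      then obtain r where r: "r \<in> {0, 1, 2}" "r \<noteq> f" "r \<noteq> g"
        by blast
      then have "r < n - 1"
        using n4 by auto
      moreover obtain m where "m \<in> teams n" "m \<noteq> t" "col t m = r"
        using one_factorization_mate[OF col tj_facts(1) \<open>r < n - 1\<close>] .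
      ultimately show ?thesis
        using that[of r m] r True by auto
    next
      case False
      then show ?thesis
        using that[of "col j t" j] cj ori(2) tj_facts by auto
    qed
    define h where "h i = (if i = k + 1 then (f, True) else if i = q then (g, True)
      else if i = 1 then (col j t, False) else (r, ori t m))" for i
    have h: "h (k + 1) = (f, True)" "h q = (g, True)" "h 1 = (col j t, False)" "k \<noteq> 1 \<Longrightarrow> h k = (r, ori t m)"
      using q k_facts(1) by (auto simp: h_def)
    \<comment> \<open>For k = 1, slots k and 1 coincide and only three rounds are
      prescribed.\<close>
    define P where "P = (if k = 1 then {k + 1, q, 1} else {k + 1, q, 1, k})"
    have "inj_on h P"
    proof (cases "k = 1")
      case True
      then have P: "P = {k + 1, q, 1}"
        by (simp add: P_def)
      show ?thesis
        using fg unfolding P inj_on_def ball_simps h(1,2,3) by auto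
    next
      case False
      then have P: "P = {k + 1, q, 1, k}"
        by (simp add: P_def)
      show ?thesis
        using fg r(5) unfolding P inj_on_def ball_simps h(1,2,3) h(4)[OF False] by auto
    qed
    moreover have "h ` P \<subseteq> rounds n"
      using fg r(1) cj(1) by (auto simp: h_def)
    moreover have "P \<subseteq> slots n" "n \<ge> 1"
      using q k_facts n4 by (auto simp: P_def)
    ultimately obtain s where s: "bij_betw s (slots n) (rounds n)" "\<And>i. i \<in> P \<Longrightarrow> s i = h i"
      using slot_assignment_extend by metis
    have "{k + 1, q, 1} \<subseteq> P" "k \<noteq> 1 \<Longrightarrow> k \<in> P"
      by (auto simp: P_def)
    then have sv: "s (k + 1) = (f, True)" "s q = (g, True)" "s 1 = (col j t, False)"
      "k \<noteq> 1 \<Longrightarrow> s k = (r, ori t m)"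
      using s(2) h by auto
    have tight: "tight (schedule n col ori s')"
      if s': "bij_betw s' (slots n) (rounds n)" "s' 1 = (col j t, False)" "k \<noteq> 1 \<Longrightarrow> s' k = (r, ori t m)" for s'
    proof (rule tight_first)
      show "tournament n (schedule n col ori s')"
        by (rule tournament_schedule[OF col ori(1) s'(1)])
      show "(1, j, t) \<in> schedule n col ori s'"
        using s'(2) k_facts tj_facts not_ori by (simp add: mem_schedule)
      show "k = 1 \<or> (k, t, m) \<in> schedule n col ori s'"
        using s'(3) k_facts tj_facts r by (auto simp: mem_schedule mem_arcs)
    qed
    have "tight (schedule n col ori s)"
      by (rule tight) (use s(1) sv in auto)
    moreover have "tight (schedule n col ori (s(k + 1 := s q, q := s (k + 1))))"
      by (rule tight) (use bij_betw_swap_slots[OF s(1) k_facts(3) q(1)] sv(3,4) q k_facts in auto)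
    ultimately show "\<exists>s. bij_betw s (slots n) (rounds n) \<and> s (k + 1) = (f, True) \<and> s q = (g, True) \<and>
        tight (schedule n col ori s) \<and> tight (schedule n col ori (s(k + 1 := s q, q := s (k + 1))))"
      using s(1) sv(1,2) by blast
  qed
qed

text \<open>Comparing every slot with slot 1 expresses \<open>c\<close> by potentials up to a
  correction on (j, t). The weight then depends only on the slot of (j, t), and a tight tournament
  with the same slot has weight \<delta>.\<close>

lemma weight_const_if_const_on_tight:
  assumes const: "\<And>T. tight T \<Longrightarrow> weight n c T = \<delta>" and T: "tournament n T"
  shows "weight n c T = \<delta>"
proof -
  have "\<exists>u. \<forall>(a, b)\<in>arcs n - {(j, t)}. c p a b - c 1 a b = u a + u b" if p: "p \<in> slots n" for p
  proof -
    consider "p = 1" | "p \<noteq> 1" "p \<noteq> k + 1" | "p = k + 1"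
      by blast
    then show ?thesis
    proof cases
      case 1
      then show ?thesis
        by (intro exI[of _ "\<lambda>_. 0"]) auto
    next
      case 2
      show ?thesis
        by (rule potential_away_from_next[OF p k_facts(4) 2 k_facts(5) const])
    next
      case 3
      \<comment> \<open>Slot k + 1 is compared with slot 1 through an intermediate slot, because
        \<open>potential_next\<close> keeps slot 1 fixed.\<close>
      have "\<exists>q\<in>{2, 3, 4::nat}. q \<noteq> k \<and> q \<noteq> k + 1"
        by auto
      then obtain q where q: "q \<in> {2, 3, 4}" "q \<noteq> k" "q \<noteq> k + 1"
        by blast
      then have q': "q \<in> slots n" "q \<noteq> 1" "q \<notin> {1, k, k + 1}"
        using n4 by (auto simp: slots_def)
      obtain u where u: "\<forall>(a, b)\<in>arcs n - {(j, t)}. c (k + 1) a b - c q a b = u a + u b"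
        using potential_next[OF q'(1,3) const] by blast
      obtain v where v: "\<forall>(a, b)\<in>arcs n - {(j, t)}. c q a b - c 1 a b = v a + v b"
        using potential_away_from_next[OF q'(1) k_facts(4) q'(2) q(3) k_facts(5) const] by blast
      have "c p a b - c 1 a b = (u a + v a) + (u b + v b)" if "(a, b) \<in> arcs n - {(j, t)}" for a b
        using bspec[OF u that] bspec[OF v that] 3 by simp
      then show ?thesis
        by (intro exI[of _ "\<lambda>a. u a + v a"]) blast
    qed
  qed
  then have "\<forall>p\<in>slots n. \<exists>u. \<forall>(a, b)\<in>arcs n - {(j, t)}. c p a b - c 1 a b = u a + u b"
    by blast
  from bchoice[OF this] obtain u where
    "\<forall>p\<in>slots n. \<forall>(a, b)\<in>arcs n - {(j, t)}. c p a b - c 1 a b = u p a + u p b" ..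
  then have u: "c p a b - c 1 a b = u p a + u p b"
    if "p \<in> slots n" "(a, b) \<in> arcs n" "(a, b) \<noteq> (j, t)" for p a b
    using that by blast
  \<comment> \<open>The deviation of \<open>c p\<close> on (j, t), where the exchange argument gives
    no information.\<close>
  define g where "g p = c p j t - c 1 j t - u p j - u p t" for p
  have c: "c p a b = c 1 a b + u p a + u p b + (if (a, b) = (j, t) then g p else 0)"
    if "p \<in> slots n" "(a, b) \<in> arcs n" for p a b
    using u[OF that] by (cases "(a, b) = (j, t)") (auto simp: g_def)
  have wt: "weight n c S = (\<Sum>(a, b)\<in>arcs n. c 1 a b) + (\<Sum>p\<in>slots n. \<Sum>a\<in>teams n. u p a) + g s"
    if "tournament n S" "(s, j, t) \<in> S" for S s
    by (rule weight_potential[OF that(1) n2 that(2)]) (rule c)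
  obtain s where s: "s \<in> slots n" "(s, j, t) \<in> T"
    using tournament_arc_ex1[OF T tj_facts(5)] by blast
  obtain T' where T': "tight T'" "(s, j, t) \<in> T'"
    using ex_tight[OF s(1)] .
  have "tournament n T'"
    using T'(1) by (simp add: tight_def)
  then have "weight n c T = weight n c T'"
    using wt[OF T s(2)] wt[OF _ T'(2)] by simp
  then show ?thesis
    using const[OF T'(1)] by simp
qed

text \<open>The x-coefficients of the inequality, as a sum so that coinciding terms add up: for k =
  1 the coefficient at (1, j, t) is 2.\<close>

definition coef :: "nat \<Rightarrow> nat \<Rightarrow> nat \<Rightarrow> real" where
  "coef p a b = of_bool ((p, a, b) = (1, j, t)) + of_bool ((p, a, b) = (k, j, t))
     + (\<Sum>i\<in>teams n - {t}. of_bool ((p, a, b) = (k, t, i))) + of_bool ((p, a, b) = (k + 1, j, t))"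

lemma weight_coef: "weight n coef T = lhs T + 1"
proof -
  have "weight n (\<lambda>p a b. of_bool ((p, a, b) = (k, t, i))) T = indicator T (k, t, i)" if "i \<in> teams n - {t}" for i
    by (rule weight_single[OF k_facts(2)]) (use that tj_facts in \<open>auto simp: mem_arcs\<close>)
  then show ?thesis
    unfolding coef_def weight_add weight_sum[OF finite_Diff[OF finite_teams]]
      weight_single[OF k_facts(2) tj_facts(5)] weight_single[OF k_facts(3) tj_facts(5)] weight_single[OF k_facts(4) tj_facts(5)]
    by (simp add: lhs_def)
qed

end

section \<open>Facets of a convex hull\<close>

lemma linear_functional_inner:
  fixes h :: "'a::euclidean_space \<Rightarrow> real"
  assumes "linear h"
  obtains w where "\<And>p. h p = w \<bullet> p"
proof
  fix p
  have "h p = h (\<Sum>i\<in>Basis. (p \<bullet> i) *\<^sub>R i)"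
    by (simp add: euclidean_representation)
  also have "\<dots> = (\<Sum>i\<in>Basis. (p \<bullet> i) * h i)"
    using assms by (simp add: linear_sum linear_scale)
  also have "\<dots> = (\<Sum>i\<in>Basis. h i *\<^sub>R i) \<bullet> p"
    by (simp add: inner_sum_left inner_sum_right inner_commute mult.commute)
  finally show "h p = (\<Sum>i\<in>Basis. h i *\<^sub>R i) \<bullet> p" .
qed

text \<open>The functional is the component of v - s0 orthogonal to the direction space of the
  affine hull; it is nonzero because v lies outside.\<close>

lemma separate_from_affine_hull:
  fixes S :: "'a::euclidean_space set"
  assumes "s0 \<in> S" "v \<notin> affine hull S"
  obtains a where "\<And>x. x \<in> S \<Longrightarrow> a \<bullet> x = a \<bullet> s0" "a \<bullet> v \<noteq> a \<bullet> s0"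
proof -
  let ?W = "(\<lambda>x. - s0 + x) ` S"
  have hull: "affine hull S = (+) s0 ` span ?W"
    using assms(1) by (intro affine_hull_span_gen hull_inc)
  obtain y z where yz: "y \<in> span ?W" "\<And>w. w \<in> span ?W \<Longrightarrow> orthogonal z w" "v - s0 = y + z"
    using orthogonal_subspace_decomp_exists by blast
  have "z \<noteq> 0"
  proof
    assume "z = 0"
    then have "v = s0 + y"
      using yz(3) by (simp add: algebra_simps)
    then show False
      using assms(2) yz(1) unfolding hull by blast
  qed
  have "z \<bullet> (- s0 + x) = 0" if "x \<in> S" for x
    using yz(2)[of "- s0 + x"] that by (auto simp: orthogonal_def span_base)
  then have "z \<bullet> x = z \<bullet> s0" if "x \<in> S" for x
    using that by (auto simp: inner_diff_right)
  moreover have "z \<bullet> (v - s0) = z \<bullet> z"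
    using yz(2)[OF yz(1)] by (simp add: yz(3) inner_add_right orthogonal_def)
  then have "z \<bullet> v \<noteq> z \<bullet> s0"
    using \<open>z \<noteq> 0\<close> by (auto simp: inner_diff_right)
  ultimately show ?thesis
    by (rule that)
qed

text \<open>Adding one point q off the face already spans V affinely: otherwise a functional
  constant on the face and q would separate some v. By \<open>multiple\<close> it is a constant plus
  m * (h - b), and its value at q forces m = 0, a contradiction.\<close>

lemma facet_of_convex_hull:
  fixes V :: "'a::euclidean_space set"
  assumes lin: "linear h" and le: "\<And>v. v \<in> V \<Longrightarrow> h v \<le> b"
    and v0: "v0 \<in> V" "h v0 = b" and q: "q \<in> V" "h q < b"
    and multiple: "\<And>a \<delta>. (\<And>v. v \<in> V \<Longrightarrow> h v = b \<Longrightarrow> a \<bullet> v = \<delta>) \<Longrightarrow> \<exists>m. \<forall>v\<in>V. a \<bullet> v = \<delta> + m * (h v - b)"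
  shows "\<forall>p\<in>convex hull V. h p \<le> b" "{p \<in> convex hull V. h p = b} facet_of convex hull V"
proof -
  let ?P = "convex hull V"
  let ?F = "{p \<in> ?P. h p = b}"
  obtain w where w: "\<And>p. h p = w \<bullet> p"
    using linear_functional_inner[OF lin] by blast
  have "?P \<subseteq> {p. w \<bullet> p \<le> b}"
    using le by (intro hull_minimal convex_halfspace_le) (auto simp: w)
  then show valid: "\<forall>p\<in>?P. h p \<le> b"
    by (auto simp: w)
  have "?P \<inter> {p. w \<bullet> p = b} face_of ?P"
    using valid by (intro face_of_Int_supporting_hyperplane_le convex_convex_hull) (auto simp: w)
  moreover have "?P \<inter> {p. w \<bullet> p = b} = ?F"
    by (auto simp: w)
  ultimately have face: "?F face_of ?P"
    by simp
  have v0F: "v0 \<in> ?F"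
    using v0 by (simp add: hull_inc)
  have "q \<in> ?P" "q \<notin> ?F"
    using q by (auto simp: hull_inc)
  then have "aff_dim ?F < aff_dim ?P"
    using face by (intro face_of_aff_dim_lt convex_convex_hull) auto
  moreover have "V \<subseteq> affine hull (insert q ?F)"
  proof (rule ccontr)
    assume "\<not> V \<subseteq> affine hull (insert q ?F)"
    then obtain v where v: "v \<in> V" "v \<notin> affine hull (insert q ?F)"
      by blast
    obtain a where a: "\<And>x. x \<in> insert q ?F \<Longrightarrow> a \<bullet> x = a \<bullet> v0" "a \<bullet> v \<noteq> a \<bullet> v0"
      using separate_from_affine_hull[OF insertI2[OF v0F] v(2)] by blast
    have "a \<bullet> x = a \<bullet> v0" if "x \<in> V" "h x = b" for x
      using that by (intro a(1)) (simp add: hull_inc)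
    from multiple[OF this] obtain m where m: "\<And>x. x \<in> V \<Longrightarrow> a \<bullet> x = a \<bullet> v0 + m * (h x - b)"
      by blast
    have "m = 0"
      using m[OF q(1)] a(1)[of q] q(2) by simp
    then show False
      using m[OF v(1)] a(2) by simp
  qed
  then have "?P \<subseteq> affine hull (insert q ?F)"
    by (intro hull_minimal affine_imp_convex affine_affine_hull)
  then have "aff_dim ?P \<le> aff_dim ?F + 1"
    using aff_dim_subset[of ?P "affine hull (insert q ?F)"] by (simp add: aff_dim_insert split: if_splits)
  ultimately have "aff_dim ?F = aff_dim ?P - 1"
    by simp
  then show "?F facet_of ?P"
    using face v0F unfolding facet_of_def by blast
qed

section \<open>Coordinates\<close>

lemma bij_betw_Abs_match_ix:
  assumes "CARD('n) = n" "n \<ge> 2"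
  shows "bij_betw (Abs_match_ix :: _ \<Rightarrow> 'n match_ix) (matches n) UNIV"
  using type_definition.Abs_image[OF type_definition_match_ix[where 'n = 'n]] Abs_match_ix_inject[where 'n = 'n] assms
  by (auto simp: bij_betw_def inj_on_def max_absorb2)

lemma Rep_Abs_match_ix:
  assumes "CARD('n) = n" "n \<ge> 2" "m \<in> matches n"
  shows "Rep_match_ix (Abs_match_ix m :: 'n match_ix) = m"
  using Abs_match_ix_inverse[where 'n = 'n] assms by (simp add: max_absorb2)

lemma Rep_Abs_travel_ix:
  assumes "CARD('n) = n" "n \<ge> 2" "m \<in> teams n \<times> arcs n"
  shows "Rep_travel_ix (Abs_travel_ix m :: 'n travel_ix) = m"
  using Abs_travel_ix_inverse[where 'n = 'n] assms by (simp add: max_absorb2)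

lemma Rep_travel_ix_mem:
  assumes "CARD('n) = n" "n \<ge> 2"
  shows "Rep_travel_ix (c :: 'n travel_ix) \<in> teams n \<times> arcs n"
  using Rep_travel_ix[of c] assms by (simp add: max_absorb2)

lemma xc_chi:
  fixes y :: "real ^ 'n travel_ix"
  assumes "CARD('n) = n" "n \<ge> 2" "p \<in> slots n" "(a, b) \<in> arcs n"
  shows "xc (chi T, y) p a b = indicator T (p, a, b)"
  using assms by (simp add: xc_def chi_def Rep_Abs_match_ix[OF assms(1,2)] matches_def)

lemma inner_chi:
  fixes w :: "(real ^ 'n match_ix) \<times> (real ^ 'n travel_ix)"
  assumes "CARD('n) = n" "n \<ge> 2"
  shows "w \<bullet> (chi T, y) = weight n (xc w) T + snd w \<bullet> y"
proof -
  have "fst w \<bullet> chi T = (\<Sum>m\<in>UNIV. fst w $ m * (chi T :: real ^ 'n match_ix) $ m)"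
    by (simp add: inner_vec_def)
  also have "\<dots> = (\<Sum>m\<in>matches n. fst w $ Abs_match_ix m * (chi T :: real ^ 'n match_ix) $ Abs_match_ix m)"
    using sum.reindex_bij_betw[OF bij_betw_Abs_match_ix[OF assms], of "\<lambda>m. fst w $ m * (chi T :: real ^ 'n match_ix) $ m"] by simp
  also have "\<dots> = (\<Sum>(p, a, b)\<in>slots n \<times> arcs n. indicator T (p, a, b) * xc w p a b)"
    unfolding matches_def[symmetric]
    by (rule sum.cong) (auto simp: chi_def xc_def Rep_Abs_match_ix[OF assms])
  also have "\<dots> = weight n (xc w) T"
    unfolding weight_def by (simp add: sum.cartesian_product case_prod_beta)
  finally show ?thesis
    by (cases w) (simp add: inner_prod_def)
qed

lemma linear_xc: "linear (\<lambda>p. xc p k i j)"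
  by (rule linearI) (simp_all add: xc_def)

lemma linear_yc: "linear (\<lambda>p. yc p t i j)"
  by (rule linearI) (simp_all add: yc_def)

section \<open>The face spans a hyperplane of the affine hull of the polytope\<close>

theorem theorem10:
  fixes n k t j :: nat
  assumes "CARD('n::finite) = n"
    and "n \<ge> 4" and "even n"
    and "k \<in> slots n - {2 * n - 2}"
    and "(t, j) \<in> arcs n"
  shows "facet_defining (P_utt :: ((real ^ 'n match_ix) \<times> (real ^ 'n travel_ix)) set)
    (\<lambda>p. xc p 1 j t + xc p k j t + (\<Sum>i \<in> teams n - {t}. xc p k t i) + xc p (k + 1) j t - 1)
    (\<lambda>p. yc p t t j)"
proof -
  interpret travel_inequality n k t j
    by unfold_locales (use assms in auto)
  note card = assms(1) n2
  \<comment> \<open>The inequality as h p \<le> 1, with the y-coordinate moved to the left and the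
    constant to the right.\<close>
  define h :: "(real ^ 'n match_ix) \<times> (real ^ 'n travel_ix) \<Rightarrow> real" where
    "h p = xc p 1 j t + xc p k j t + (\<Sum>i \<in> teams n - {t}. xc p k t i) + xc p (k + 1) j t - yc p t t j" for p
  define V :: "((real ^ 'n match_ix) \<times> (real ^ 'n travel_ix)) set" where
    "V = {(chi T, y) | T y. tournament CARD('n) T \<and> (\<forall>c. y $ c \<in> {0, 1}) \<and> (\<forall>c. psi T $ c \<le> y $ c)}"
  define c0 :: "'n travel_ix" where "c0 = Abs_travel_ix (t, t, j)"
  have V_iff: "(chi T, y) \<in> V" if "tournament n T" "\<And>c. y $ c \<in> {0, 1}" "\<And>c. psi T $ c \<le> y $ c" for T y
    unfolding V_def using that assms(1) by blast
  have psi: "psi T $ (c :: 'n travel_ix) = (case Rep_travel_ix c of (v, a, b) \<Rightarrow> of_bool (travels n T v a b))" for T c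
    by (simp add: psi_def assms(1))
  have Rep_c0: "Rep_travel_ix c0 = (t, t, j)"
    using tj tj_facts by (simp add: c0_def Rep_Abs_travel_ix[OF card])
  have psi_01: "psi T $ (c :: 'n travel_ix) \<in> {0, 1}" for T c
    by (simp add: psi split: prod.split)
  have psi_c0: "psi T $ c0 = of_bool (travels n T t t j)" for T
    by (simp add: psi Rep_c0)
  have h_chi: "h (chi T, y) = lhs T + 1 - y $ c0" for T y
  proof -
    have "xc (chi T, y) k t i = indicator T (k, t, i)" if "i \<in> teams n - {t}" for i
      by (rule xc_chi[OF card k_facts(2)]) (use that tj_facts in \<open>auto simp: mem_arcs\<close>)
    then show ?thesis
      by (simp add: h_def lhs_def yc_def c0_def xc_chi[OF card k_facts(2) tj_facts(5)]
          xc_chi[OF card k_facts(3) tj_facts(5), simplified] xc_chi[OF card k_facts(4) tj_facts(5), simplified])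
  qed
  have "linear h"
    unfolding h_def by (intro linear_compose_sub linear_compose_add linear_compose_sum linear_xc linear_yc ballI)
  have le: "h v \<le> 1" if vV: "v \<in> V" for v
  proof -
    obtain T y where v: "v = (chi T, y)" "tournament n T" "psi T $ c0 \<le> y $ c0"
      using vV unfolding V_def assms(1) by blast
    then show ?thesis
      using lhs_le_travels[OF v(2)] by (simp add: h_chi psi_c0)
  qed
  \<comment> \<open>The travel vector, altered at y(t, t, j) to the value \<open>lhs T\<close> that
    yields equality.\<close>
  define Y :: "(nat \<times> nat \<times> nat) set \<Rightarrow> real ^ 'n travel_ix" where
    "Y T = (\<chi> c. if c = c0 then lhs T else psi T $ c)" for T
  have Y: "(chi T, Y T) \<in> V" "h (chi T, Y T) = 1" if "tight T" for T
  proof -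
    have "lhs T \<in> {0, 1}" "of_bool (travels n T t t j) \<le> lhs T"
      using that by (auto simp: tight_def)
    then show "(chi T, Y T) \<in> V"
      using that psi_01 by (intro V_iff) (auto simp: Y_def psi_c0 tight_def)
    show "h (chi T, Y T) = 1"
      by (simp add: h_chi Y_def)
  qed
  obtain T0 where T0: "tight T0"
    using ex_tight[OF k_facts(4)] by blast
  \<comment> \<open>A vertex off the face: with (j, t) in slot k + 1 and t away in slot k,
    \<open>lhs\<close> is 0, while all y-coordinates are set to 1.\<close>
  obtain q where q: "q \<in> V" "h q < 1"
  proof -
    obtain x y where xy: "x \<in> teams n" "y \<in> teams n" "x \<noteq> y" "x \<noteq> t" "y \<noteq> t" "x \<noteq> j" "y \<noteq> j"
      "(x, t) \<in> arcs n" "(t, x) \<in> arcs n" "(t, y) \<in> arcs n"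
      by (rule ex_two_opponents)
    have "(j, t) \<noteq> (x, t)"
      using xy by simp
    obtain T where T: "tournament n T" "(k + 1, j, t) \<in> T" "(k, x, t) \<in> T"
      by (rule tournament_with_two_matches[OF n4 even_n k_facts(3,2) k_facts(6)[symmetric] tj_facts(5) xy(8) \<open>(j, t) \<noteq> (x, t)\<close>])
    have "lhs T = 0"
      using not_home_if_away[OF T(1,3)] k_facts(1) unfolding lhs_eq[OF T(1,2)] by simp
    moreover have "psi T $ (c :: 'n travel_ix) \<le> 1" for c
      using psi_01[of T c] by auto
    ultimately show ?thesis
      using that[of "(chi T, \<chi> c. 1)"] T(1) by (simp add: V_iff h_chi)
  qed
  have multiple: "\<exists>m. \<forall>v\<in>V. w \<bullet> v = \<delta> + m * (h v - 1)"
    if w: "\<And>v. v \<in> V \<Longrightarrow> h v = 1 \<Longrightarrow> w \<bullet> v = \<delta>" for w \<delta>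
  proof -
    define d where "d = snd w $ c0"
    \<comment> \<open>Two vertices of the face that differ only in coordinate c show that its
      coefficient vanishes.\<close>
    have zero: "snd w $ c = 0" if "c \<noteq> c0" for c
    proof -
      obtain v a b where vab: "Rep_travel_ix c = (v, a, b)"
        by (cases "Rep_travel_ix c") auto
      have "(v, a, b) \<in> teams n \<times> arcs n"
        using Rep_travel_ix_mem[OF card, of c] by (simp add: vab)
      moreover have "(v, a, b) \<noteq> (t, t, j)"
        using that vab Rep_c0 by (metis Rep_travel_ix_inject)
      ultimately obtain T where T: "tight T" "\<not> travels n T v a b"
        using ex_tight_not_travelling by blast
      define y where "y = Y T + axis c 1"
      have psi_c: "psi T $ c = 0"
        using T(2) by (simp add: psi vab)
      then have "Y T $ c = 0"
        using that by (simp add: Y_def)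
      then have yc: "y $ c' = (if c' = c then 1 else Y T $ c')" for c'
        by (simp add: y_def axis_def)
      have "lhs T \<in> {0, 1}" "of_bool (travels n T t t j) \<le> lhs T"
        using T(1) by (auto simp: tight_def)
      then have "(chi T, y) \<in> V"
        using T(1) psi_01 by (intro V_iff) (auto simp: yc Y_def psi_c0 tight_def psi_c)
      moreover have "h (chi T, y) = 1"
        using that by (simp add: h_chi yc Y_def)
      ultimately have "w \<bullet> (chi T, y) = w \<bullet> (chi T, Y T)"
        using w Y[OF T(1)] by simp
      then show ?thesis
        by (simp add: inner_chi[OF card] y_def inner_add_right inner_axis)
    qed
    have snd_w: "snd w \<bullet> y = d * y $ c0" for y
    proof -
      have "snd w \<bullet> y = (\<Sum>c\<in>UNIV. if c = c0 then d * y $ c0 else 0)"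
        unfolding inner_vec_def using zero by (intro sum.cong) (auto simp: d_def)
      then show ?thesis
        by simp
    qed
    \<comment> \<open>Adding \<open>d\<close> times the inequality cancels the remaining
      y-coefficient, which leaves a weight function on the matches with value \<delta> + d on tight
      tournaments.\<close>
    define c where "c p a b = xc w p a b + d * coef p a b" for p a b
    have weight_c: "weight n c T = weight n (xc w) T + d * (lhs T + 1)" for T
      unfolding c_def weight_add weight_scale weight_coef ..
    have "weight n c T = \<delta> + d" if "tight T" for T
      using w[OF Y[OF that]] by (simp add: weight_c inner_chi[OF card] snd_w Y_def algebra_simps)
    then have const: "weight n c T = \<delta> + d" if "tournament n T" for T
      using weight_const_if_const_on_tight that by blast
    have "w \<bullet> v = \<delta> + - d * (h v - 1)" if vV: "v \<in> V" for v
    proof -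
      obtain T y where v: "v = (chi T, y)" "tournament n T"
        using vV unfolding V_def assms(1) by blast
      then show ?thesis
        using const[OF v(2)] by (simp add: v(1) weight_c inner_chi[OF card] snd_w h_chi algebra_simps)
    qed
    then show ?thesis
      by blast
  qed
  have "\<forall>p\<in>convex hull V. h p \<le> 1" "{p \<in> convex hull V. h p = 1} facet_of convex hull V"
    using facet_of_convex_hull[OF \<open>linear h\<close> le Y[OF T0] q multiple] by blast+
  moreover have "P_utt = convex hull V"
    by (simp add: P_utt_def V_def)
  ultimately show ?thesis
    by (simp add: facet_defining_def h_def algebra_simps)
qed

end
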